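(* Let $\mu=\mathcal N(0,\mathcal C)$ be a centered Gaussian on $\mathbb R^{n_u}\times\mathbb R^{n_v}$ with strictly positive-definite covariance $\mathcal C=\begin{bmatrix}\mathcal C_{uu}&\mathcal C_{uv}\\ \mathcal C_{vu}&\mathcal C_{vv}\end{bmatrix}$ and marginals $\mu_u,\mu_v$. Consider the model $\nu(du,dv)=\frac1Z\exp(-\frac12|Gu-Hv|^2)\mu_u(du)\mu_v(dv)$, whose conditional $\nu_{u|v}$ depends on $(G,H)$ only through $A=G^\top H$ and $B=G^\top G$ and is denoted $\nu_{u|v}(\cdot|v;A,B)$. Let $(A^\ast,B^\ast)$ be the minimizer, over $A\in\mathbb R^{n_u\times n_v}$ and symmetric $B\in\mathbb R^{n_u\times n_u}$, of the one-sided conditional loss $\mathsf L_{\mathsf{cond}}(A,B;2,0)$ defined in the context. Then $$\nu_{u|v}(\cdot|v;A^\ast,B^\ast)=\mathcal N\bigl(\mathcal C_{uv}\mathcal C_{vv}^{-1}v,\ \mathcal C_{uu}-\mathcal C_{uv}\mathcal C_{vv}^{-1}\mathcal C_{vu}\bigr),$$ which is exactly the conditional distribution $\mu_{u|v}(\cdot|v)$ of $\mu$.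
   Context: The model conditional is the probability measure $\nu_{u|v}(du|v;A,B)\propto\exp(-\frac12\langle u,Bu\rangle+\langle u,Av\rangle)\mu_u(du)$, which (when $B+\mathcal C_{uu}^{-1}$ is positive definite) equals $\mathcal N((B+\mathcal C_{uu}^{-1})^{-1}Av,(B+\mathcal C_{uu}^{-1})^{-1})$. The one-sided loss is $$\mathsf L_{\mathsf{cond}}(A,B;2,0)=\mathbb E_{(u,v)\sim\mu}\Bigl[\tfrac12\langle u,Bu\rangle-\langle u,Av\rangle\Bigr]+\mathbb E_{v\sim\mu_v}\Bigl[\log\mathbb E_{u\sim\mu_u}\exp\bigl(-\tfrac12\langle u,Bu\rangle+\langle u,Av\rangle\bigr)\Bigr],$$ with value $+\infty$ when the inner expectation is infinite. Its minimizer is $A^\ast=\mathcal C_{u|v}^{-1}\mathcal C_{uv}\mathcal C_{vv}^{-1}$, $B^\ast=\mathcal C_{uu}^{-1}\mathcal C_{uv}\mathcal C_{v|u}^{-1}\mathcal C_{vu}\mathcal C_{uu}^{-1}$, where $\mathcal C_{u|v}=\mathcal C_{uu}-\mathcal C_{uv}\mathcal C_{vv}^{-1}\mathcal C_{vu}$ and $\mathcal C_{v|u}=\mathcal C_{vv}-\mathcal C_{vu}\mathcal C_{uu}^{-1}\mathcal C_{uv}$. *)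

theory Defs
  imports "HOL-Probability.Probability"
begin

definition pos_def_matrix :: "real^'n^'n \<Rightarrow> bool" where
  "pos_def_matrix S \<longleftrightarrow> transpose S = S \<and> (\<forall>x. x \<noteq> 0 \<longrightarrow> 0 < x \<bullet> (S *v x))"

text \<open>\<open>\<N>(m, S)\<close> is given by its Lebesgue density, which is meaningful only for a positive definite
  covariance \<open>S\<close>; degenerate Gaussians are not covered.\<close>

definition gaussian :: "real^'n \<Rightarrow> real^'n^'n \<Rightarrow> (real^'n) measure" where
  "gaussian m S = density lborel (\<lambda>x. ennreal
     (exp (- (1/2) * ((x - m) \<bullet> (matrix_inv S *v (x - m)))) / sqrt ((2 * pi) ^ CARD('n) * det S)))"

text \<open>The covariance of a Gaussian vector \<open>(u, v)\<close> is a matrix over the disjoint sum of the index types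
  of \<open>u\<close> and \<open>v\<close>; \<open>C_uu\<close>, \<open>C_uv\<close>, \<open>C_vu\<close>, \<open>C_vv\<close> are its blocks.\<close>

definition C_uu :: "real^('u::finite + 'v::finite)^('u + 'v) \<Rightarrow> real^'u^'u" where
  "C_uu C = (\<chi> i j. C $ Inl i $ Inl j)"

definition C_uv :: "real^('u::finite + 'v::finite)^('u + 'v) \<Rightarrow> real^'v^'u" where
  "C_uv C = (\<chi> i j. C $ Inl i $ Inr j)"

definition C_vu :: "real^('u::finite + 'v::finite)^('u + 'v) \<Rightarrow> real^'u^'v" where
  "C_vu C = (\<chi> i j. C $ Inr i $ Inl j)"

definition C_vv :: "real^('u::finite + 'v::finite)^('u + 'v) \<Rightarrow> real^'v^'v" where
  "C_vv C = (\<chi> i j. C $ Inr i $ Inr j)"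

definition C_u_given_v :: "real^('u::finite + 'v::finite)^('u + 'v) \<Rightarrow> real^'u^'u" where
  "C_u_given_v C = C_uu C - C_uv C ** matrix_inv (C_vv C) ** C_vu C"

definition C_v_given_u :: "real^('u::finite + 'v::finite)^('u + 'v) \<Rightarrow> real^'v^'v" where
  "C_v_given_u C = C_vv C - C_vu C ** matrix_inv (C_uu C) ** C_uv C"

definition A_star :: "real^('u::finite + 'v::finite)^('u + 'v) \<Rightarrow> real^'v^'u" where
  "A_star C = matrix_inv (C_u_given_v C) ** C_uv C ** matrix_inv (C_vv C)"

definition B_star :: "real^('u::finite + 'v::finite)^('u + 'v) \<Rightarrow> real^'u^'u" where
  "B_star C = matrix_inv (C_uu C) ** C_uv C ** matrix_inv (C_v_given_u C) ** C_vu C ** matrix_inv (C_uu C)"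

text \<open>The centred Gaussian with covariance \<open>C\<close>, carried from the sum-indexed space to the product space.\<close>

definition joint_gaussian ::
    "real^('u::finite + 'v::finite)^('u + 'v) \<Rightarrow> ((real^'u) \<times> (real^'v)) measure" where
  "joint_gaussian C = distr (gaussian 0 C) borel (\<lambda>z. (\<chi> i. z $ Inl i, \<chi> j. z $ Inr j))"

definition marginal_u :: "('a::topological_space \<times> 'b::topological_space) measure \<Rightarrow> 'a measure" where
  "marginal_u \<mu> = distr \<mu> borel fst"

definition marginal_v :: "('a::topological_space \<times> 'b::topological_space) measure \<Rightarrow> 'b measure" where
  "marginal_v \<mu> = distr \<mu> borel snd"

text \<open>\<open>K\<close> is (a version of) the regular conditional distribution of \<open>u\<close> given \<open>v\<close> when
  \<open>(u, v)\<close> has law \<open>\<mu>\<close>; such a \<open>K\<close> is determined up to a \<open>marginal_v \<mu>\<close>-null set.\<close>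

definition is_conditional_u_given_v ::
    "('a::topological_space \<times> 'b::topological_space) measure \<Rightarrow> ('b \<Rightarrow> 'a measure) \<Rightarrow> bool" where
  "is_conditional_u_given_v \<mu> K \<longleftrightarrow>
     K \<in> borel \<rightarrow>\<^sub>M prob_algebra borel \<and>
     (\<forall>S \<in> sets borel. \<forall>T \<in> sets borel.
        emeasure \<mu> (S \<times> T) = (\<integral>\<^sup>+ v \<in> T. emeasure (K v) S \<partial>marginal_v \<mu>))"

text \<open>\<open>\<nu>(du, dv) = Z\<^sup>-\<^sup>1 exp(- |Gu - Hv|\<^sup>2 / 2) \<mu>\<^sub>u(du) \<mu>\<^sub>v(dv)\<close>\<close>

definition model_joint ::
    "((real^'u) \<times> (real^'v)) measure \<Rightarrow> real^'u^'k \<Rightarrow> real^'v^'k \<Rightarrow> ((real^'u) \<times> (real^'v)) measure" where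
  "model_joint \<mu> G H =
     (let M = marginal_u \<mu> \<Otimes>\<^sub>M marginal_v \<mu>;
          w = (\<lambda>(u, v). ennreal (exp (- (1/2) * (norm (G *v u - H *v v))\<^sup>2)))
      in density M (\<lambda>p. w p / (\<integral>\<^sup>+ q. w q \<partial>M)))"

definition cond_normalizer ::
    "((real^'u) \<times> (real^'v)) measure \<Rightarrow> real^'v^'u \<Rightarrow> real^'u^'u \<Rightarrow> real^'v \<Rightarrow> ennreal" where
  "cond_normalizer \<mu> A B v =
     (\<integral>\<^sup>+ u. ennreal (exp (- (1/2) * (u \<bullet> (B *v u)) + u \<bullet> (A *v v))) \<partial>marginal_u \<mu>)"

text \<open>\<open>\<nu>\<^sub>u\<^sub>|\<^sub>v(\<cdot>|v; A, B)\<close>; a probability measure exactly when the normalizer is finite.\<close>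

definition model_cond ::
    "((real^'u) \<times> (real^'v)) measure \<Rightarrow> real^'v^'u \<Rightarrow> real^'u^'u \<Rightarrow> real^'v \<Rightarrow> (real^'u) measure" where
  "model_cond \<mu> A B v = density (marginal_u \<mu>)
     (\<lambda>u. ennreal (exp (- (1/2) * (u \<bullet> (B *v u)) + u \<bullet> (A *v v))) / cond_normalizer \<mu> A B v)"

text \<open>The one-sided loss. For Gaussian \<open>\<mu>\<close> the first integrand is always integrable, and wherever the
  normalizer is finite its logarithm is a quadratic polynomial in \<open>v\<close>, so both Bochner integrals are
  genuine expectations.\<close>

definition cond_loss ::
    "((real^'u) \<times> (real^'v)) measure \<Rightarrow> real^'v^'u \<Rightarrow> real^'u^'u \<Rightarrow> ereal" where
  "cond_loss \<mu> A B =
     (if AE v in marginal_v \<mu>. cond_normalizer \<mu> A B v < \<infinity>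
      then ereal ((\<integral>(u, v). (1/2) * (u \<bullet> (B *v u)) - u \<bullet> (A *v v) \<partial>\<mu>)
                + (\<integral>v. ln (enn2real (cond_normalizer \<mu> A B v)) \<partial>marginal_v \<mu>))
      else \<infinity>)"

definition is_cond_loss_minimizer ::
    "((real^'u) \<times> (real^'v)) measure \<Rightarrow> real^'v^'u \<Rightarrow> real^'u^'u \<Rightarrow> bool" where
  "is_cond_loss_minimizer \<mu> A B \<longleftrightarrow>
     is_arg_min (\<lambda>(A, B). cond_loss \<mu> A B) (\<lambda>(A, B). transpose B = B) (A, B)"

end

theory Submission
  imports Defs
begin

text \<open>The argument is Gibbs' inequality. Up to sign the loss of \<open>(A, B)\<close> is the \<open>\<mu>\<close>-expectation of the
  log-density \<open>f\<^sub>A\<^sub>B(u, v) = -u \<bullet> B u / 2 + u \<bullet> A v - ln Z(v)\<close> of the model conditional relative to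
  \<open>\<mu>\<^sub>u\<close>, and completing the square in the two Schur decompositions of the covariance shows that
  \<open>f\<close> at \<open>(A\<^sup>*, B\<^sup>*)\<close> is the log-density of \<open>\<mu>\<close> relative to \<open>\<mu>\<^sub>u \<otimes> \<mu>\<^sub>v\<close>. So \<open>(A\<^sup>*, B\<^sup>*)\<close> is optimal, and any
  other optimum has the same log-density almost everywhere, whence the quadratic and bilinear parts agree.
  A loss that is finite forces \<open>B + C\<^sub>u\<^sub>u\<^sup>-\<^sup>1\<close> to be positive definite, which makes \<open>ln Z\<close> integrable.\<close>

section \<open>Positive definite matrices\<close>

text \<open>The two integrals of the loss live on different spaces, and a Bochner integral is 0 by
  convention on a non-integrable function, whereas Gibbs' inequality needs a single log-density
  integrable under mu. A finite loss only says that Z(v) is finite for almost every v. For symmetric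
  B one such v already makes B + C_uu^-1 positive definite, a property free of v; so Z is finite
  everywhere and lies between exponentials of quadratics in v, and ln Z has quadratic growth.

  Both orders of elimination are needed because A* is written with C_u|v and B* with C_v|u.
  Comparing the two completed squares at v = 0 gives B* + C_uu^-1 = C_u|v^-1 as quadratic forms;
  this is what gives the optimal model conditional the covariance C_u|v. Block determinants never
  have to be evaluated: proportional densities of total mass one are equal.\<close>

lemma matrix_inv_right: "invertible A \<Longrightarrow> A ** matrix_inv A = mat 1"
  and matrix_inv_left: "invertible A \<Longrightarrow> matrix_inv A ** A = mat 1"
  unfolding invertible_def matrix_inv_def by (metis (mono_tags, lifting) someI_ex)+

lemma matrix_inv_unique:
  fixes A :: "real^'n^'n"
  assumes "A ** B = mat 1"
  shows "matrix_inv A = B"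
  by (metis assms invertible_right_inverse matrix_inv_left matrix_mul_assoc matrix_mul_lid matrix_mul_rid)

lemma matrix_inv_mult_vector [simp]:
  fixes A :: "real^'n^'n"
  assumes "invertible A"
  shows "A *v (matrix_inv A *v x) = x" "matrix_inv A *v (A *v x) = x"
  using assms by (simp_all add: matrix_vector_mul_assoc matrix_inv_left matrix_inv_right)

lemma inner_matrix_vector_symmetric:
  fixes A :: "real^'n^'n"
  assumes "transpose A = A"
  shows "x \<bullet> (A *v y) = (A *v x) \<bullet> y"
  by (metis assms dot_lmul_matrix transpose_matrix_vector)

lemma inner_transpose_matrix_vector:
  fixes A :: "real^'n^'m"
  shows "x \<bullet> (transpose A *v y) = (A *v x) \<bullet> y"
  by (metis dot_lmul_matrix inner_commute transpose_matrix_vector)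

lemma pos_def_matrix_invertible:
  assumes "pos_def_matrix A"
  shows "invertible A"
proof -
  have "x = 0" if "A *v x = 0" for x
    using assms that unfolding pos_def_matrix_def by (metis inner_zero_right less_irrefl)
  then show ?thesis
    by (simp add: invertible_left_inverse matrix_left_invertible_ker)
qed

lemma pos_def_matrix_inv:
  assumes "pos_def_matrix A"
  shows "pos_def_matrix (matrix_inv A)"
proof -
  have inv: "invertible A" and tr: "transpose A = A"
    using assms pos_def_matrix_invertible by (auto simp: pos_def_matrix_def)
  have "transpose (A ** transpose (matrix_inv A)) = mat 1"
    by (simp add: matrix_transpose_mul tr matrix_inv_left[OF inv])
  then have "A ** transpose (matrix_inv A) = mat 1"
    by (metis transpose_mat transpose_transpose)
  then have "transpose (matrix_inv A) = matrix_inv A"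
    using matrix_inv_unique by metis
  moreover have "0 < x \<bullet> (matrix_inv A *v x)" if "x \<noteq> 0" for x
  proof -
    define y where "y = matrix_inv A *v x"
    have x: "x = A *v y" unfolding y_def using inv by simp
    then have "y \<noteq> 0" using that by auto
    then have "0 < y \<bullet> (A *v y)"
      using assms by (simp add: pos_def_matrix_def)
    then show ?thesis
      by (simp add: x inv inner_commute)
  qed
  ultimately show ?thesis
    by (simp add: pos_def_matrix_def)
qed

text \<open>The constant is the minimum of the form on the compact unit sphere; homogeneity of
  degree two extends the bound to all vectors.\<close>

lemma pos_def_matrix_lower_bound:
  fixes A :: "real^'n^'n"
  assumes "pos_def_matrix A"
  obtains c where "c > 0" "\<And>x. c * (norm x)\<^sup>2 \<le> x \<bullet> (A *v x)"
proof -
  have "\<exists>y\<in>sphere (0::real^'n) 1. \<forall>z\<in>sphere 0 1. y \<bullet> (A *v y) \<le> z \<bullet> (A *v z)"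
    by (intro continuous_attains_inf continuous_intros matrix_vector_mult_linear_continuous_on) auto
  then obtain y :: "real^'n" where y: "norm y = 1"
    and min: "\<And>z. norm z = 1 \<Longrightarrow> y \<bullet> (A *v y) \<le> z \<bullet> (A *v z)"
    by auto
  have "y \<noteq> 0" using y by auto
  show ?thesis
  proof
    show "0 < y \<bullet> (A *v y)"
      using assms \<open>y \<noteq> 0\<close> by (simp add: pos_def_matrix_def)
    show "y \<bullet> (A *v y) * (norm x)\<^sup>2 \<le> x \<bullet> (A *v x)" for x
    proof (cases "x = 0")
      case False
      have "y \<bullet> (A *v y) \<le> (x /\<^sub>R norm x) \<bullet> (A *v (x /\<^sub>R norm x))"
        using False by (intro min) simp
      also have "\<dots> = x \<bullet> (A *v x) / (norm x)\<^sup>2"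
        by (simp add: matrix_vector_mult_scaleR power2_eq_square divide_inverse mult_ac)
      finally show ?thesis using False by (simp add: field_simps)
    qed simp
  qed
qed

text \<open>Gram-Schmidt for the inner product x . A y. The resulting congruence reduces
  determinants and Gaussian integrals for \<open>A\<close> to those of the identity matrix.\<close>

lemma pos_def_matrix_orthonormal_basis:
  fixes A :: "real^'n^'n"
  assumes A: "pos_def_matrix A"
  obtains E :: "real^'n^'n" where "transpose E ** A ** E = mat 1"
proof -
  have "\<exists>B. finite B \<and> card B = k \<and> (\<forall>x\<in>B. x \<bullet> (A *v x) = 1)
      \<and> (\<forall>x\<in>B. \<forall>y\<in>B. x \<noteq> y \<longrightarrow> x \<bullet> (A *v y) = 0)" if "k \<le> CARD('n)" for k
    using that
  proof (induction k)
    case (Suc k)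
    then obtain B where B: "finite B" "card B = k" "\<And>x. x\<in>B \<Longrightarrow> x \<bullet> (A *v x) = 1"
      "\<And>x y. x\<in>B \<Longrightarrow> y\<in>B \<Longrightarrow> x \<noteq> y \<Longrightarrow> x \<bullet> (A *v y) = 0"
      by auto
    \<comment> \<open>The images under \<open>A\<close> of fewer than n vectors do not span, so some
      nonzero \<open>z\<close> is orthogonal to all of them, that is, orthogonal to \<open>B\<close>
      in the inner product of \<open>A\<close>.\<close>
    have "dim ((*v) A ` B) \<le> card ((*v) A ` B)"
      using B(1) by (intro dim_le_card') auto
    also have "\<dots> < DIM(real^'n)"
      using card_image_le[OF B(1), of "(*v) A"] B(2) Suc.prems by simp
    finally obtain z where z: "z \<noteq> 0" "\<And>y. y \<in> span ((*v) A ` B) \<Longrightarrow> orthogonal z y"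
      by (metis orthogonal_to_subspace_exists)
    define q where "q = z \<bullet> (A *v z)"
    have "q > 0" using A z(1) by (simp add: q_def pos_def_matrix_def)
    define w where "w = z /\<^sub>R sqrt q"
    have ww: "w \<bullet> (A *v w) = 1"
      using \<open>q > 0\<close> by (simp add: w_def matrix_vector_mult_scaleR flip: q_def)
        (simp add: field_simps)
    have wB: "w \<bullet> (A *v b) = 0" if "b \<in> B" for b
      using z(2)[of "A *v b"] that by (simp add: w_def orthogonal_def span_base)
    have Bw: "b \<bullet> (A *v w) = 0" if "b \<in> B" for b
      using wB[OF that] A inner_matrix_vector_symmetric[of A b w]
      by (simp add: pos_def_matrix_def inner_commute)
    have "w \<notin> B" using wB ww by force
    then have "finite (insert w B) \<and> card (insert w B) = Suc k \<and> (\<forall>x\<in>insert w B. x \<bullet> (A *v x) = 1)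
      \<and> (\<forall>x\<in>insert w B. \<forall>y\<in>insert w B. x \<noteq> y \<longrightarrow> x \<bullet> (A *v y) = 0)"
      using B ww wB Bw by auto
    then show ?case by blast
  qed (intro exI[of _ "{}"]; simp)
  from this[OF order_refl] obtain B where B: "finite B" "card B = CARD('n)" "\<And>x. x\<in>B \<Longrightarrow> x \<bullet> (A *v x) = 1"
      "\<And>x y. x\<in>B \<Longrightarrow> y\<in>B \<Longrightarrow> x \<noteq> y \<Longrightarrow> x \<bullet> (A *v y) = 0"
    by auto
  then obtain f where f: "bij_betw f (UNIV::'n set) B"
    using finite_same_card_bij[of "UNIV::'n set" B] by auto
  define E :: "real^'n^'n" where "E = (\<chi> i j. f j $ i)"
  have "(transpose E ** A ** E) $ i $ j = f i \<bullet> (A *v f j)" for i j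
    unfolding matrix_mul_assoc[symmetric]
    by (simp add: E_def matrix_matrix_mult_def matrix_vector_mult_def transpose_def inner_vec_def)
  also have "f i \<bullet> (A *v f j) = (if i = j then 1 else 0)" for i j
    using B(3,4) f by (auto simp: bij_betw_def inj_eq)
  finally have "transpose E ** A ** E = mat 1"
    by (simp add: vec_eq_iff mat_def)
  then show ?thesis ..
qed

section \<open>Linear changes of variables and the Gaussian integral\<close>

text \<open>A relabelling of coordinates pulls a box back to a box with the same side lengths. The
  two spaces may differ, so that this covers coordinate swaps as well as reading a sum-indexed
  vector as a pair.\<close>

lemma lborel_distr_basis_permutation:
  fixes T :: "'a::euclidean_space \<Rightarrow> 'b::euclidean_space"
  assumes \<pi>: "bij_betw \<pi> Basis Basis"
    and T: "\<And>x b. b \<in> Basis \<Longrightarrow> T x \<bullet> b = x \<bullet> \<pi> b"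
    and [measurable]: "T \<in> borel_measurable borel"
  shows "distr lborel borel T = lborel"
proof (rule lborel_eqI[symmetric])
  fix l u :: 'b assume le: "\<And>b. b \<in> Basis \<Longrightarrow> l \<bullet> b \<le> u \<bullet> b"
  define \<rho> where "\<rho> = the_inv_into Basis \<pi>"
  have \<rho>: "\<rho> (\<pi> b) = b" if "b \<in> Basis" for b
    using that \<pi> by (simp add: \<rho>_def bij_betw_def the_inv_into_f_f)
  have \<pi>B: "\<pi> b \<in> Basis" if "b \<in> Basis" for b using that \<pi> by (auto simp: bij_betw_def)
  have im: "Basis = \<pi> ` Basis" using \<pi> by (simp add: bij_betw_def)
  \<comment> \<open>\<open>S\<close> moves coordinate \<open>b\<close> to position
    \<open>\<pi> b\<close>, so it sends the corners of a box to the corners of its preimage under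
    \<open>T\<close>.\<close>
  define S where "S = (\<lambda>y::'b. \<Sum>a\<in>Basis. (y \<bullet> \<rho> a) *\<^sub>R a)"
  have S: "S y \<bullet> \<pi> b = y \<bullet> b" if "b \<in> Basis" for y b
    using that by (simp add: S_def \<pi>B \<rho>)
  have "T -` box l u = box (S l) (S u)"
  proof -
    have "(\<forall>a\<in>Basis. S l \<bullet> a < x \<bullet> a \<and> x \<bullet> a < S u \<bullet> a) \<longleftrightarrow>
        (\<forall>b\<in>Basis. l \<bullet> b < T x \<bullet> b \<and> T x \<bullet> b < u \<bullet> b)" for x
      by (subst im) (simp add: S T)
    then show ?thesis by (auto simp: box_def)
  qed
  moreover have "emeasure lborel (box (S l) (S u)) = (\<Prod>a\<in>Basis. (S u - S l) \<bullet> a)"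
    using le by (intro emeasure_lborel_box) (metis S im imageE)
  moreover have "(\<Prod>a\<in>Basis. (S u - S l) \<bullet> a) = (\<Prod>b\<in>Basis. (u - l) \<bullet> b)"
    by (rule prod.reindex_bij_betw[OF \<pi>, symmetric, THEN trans]) (simp add: inner_diff_left S)
  ultimately show "emeasure (distr lborel borel T) (box l u) = (\<Prod>b\<in>Basis. (u - l) \<bullet> b)"
    by (simp add: emeasure_distr)
qed simp

lemma nn_integral_lborel_translate:
  fixes a :: "'a::euclidean_space"
  assumes [measurable]: "f \<in> borel_measurable borel"
  shows "(\<integral>\<^sup>+x. f (a + x) \<partial>lborel) = (\<integral>\<^sup>+x. f x \<partial>lborel)"
  by (subst (2) lborel_distr_plus[of a, symmetric]) (simp add: nn_integral_distr)

text \<open>Tonelli with coordinate \<open>i\<close> innermost: since \<open>j\<close> differs from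
  \<open>i\<close>, the value x . j is constant along that line, and the shear is a translation
  there.\<close>

lemma nn_integral_lborel_shear:
  fixes f :: "'a::euclidean_space \<Rightarrow> ennreal"
  assumes [measurable]: "f \<in> borel_measurable borel"
    and ij: "i \<in> Basis" "j \<in> Basis" "i \<noteq> j"
  shows "(\<integral>\<^sup>+x. f (x + (c * (x \<bullet> j)) *\<^sub>R i) \<partial>lborel) = (\<integral>\<^sup>+x. f x \<partial>lborel)"
proof -
  interpret product_sigma_finite "\<lambda>_. lborel :: real measure" ..
  have B: "Basis = insert i (Basis - {i})" using ij by auto
  have [measurable]: "(\<lambda>x. \<Sum>b\<in>Basis. x b *\<^sub>R b) \<in> borel_measurable (Pi\<^sub>M Basis (\<lambda>_. lborel :: real measure))"
    by (intro borel_measurable_sum borel_measurable_scaleR) auto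
  have sum_eq: "(\<Sum>b\<in>Basis. (x(i := y)) b *\<^sub>R b) = (\<Sum>b\<in>Basis - {i}. x b *\<^sub>R b) + y *\<^sub>R i" for x :: "'a \<Rightarrow> real" and y
  proof -
    have "(\<Sum>b\<in>Basis. (x(i := y)) b *\<^sub>R b) = y *\<^sub>R i + (\<Sum>b\<in>Basis - {i}. (x(i := y)) b *\<^sub>R b)"
      using ij by (subst sum.remove[of _ i]) auto
    also have "(\<Sum>b\<in>Basis - {i}. (x(i := y)) b *\<^sub>R b) = (\<Sum>b\<in>Basis - {i}. x b *\<^sub>R b)"
      by (intro sum.cong) auto
    finally show ?thesis by simp
  qed
  have eq: "(\<integral>\<^sup>+x. g x \<partial>lborel) = (\<integral>\<^sup>+x. \<integral>\<^sup>+y. g ((\<Sum>b\<in>Basis - {i}. x b *\<^sub>R b) + y *\<^sub>R i) \<partial>lborel \<partial>Pi\<^sub>M (Basis - {i}) (\<lambda>_. lborel))"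
    if [measurable]: "g \<in> borel_measurable borel" for g :: "'a \<Rightarrow> ennreal"
  proof -
    have m: "(\<lambda>x. g (\<Sum>b\<in>Basis. x b *\<^sub>R b)) \<in> borel_measurable (Pi\<^sub>M Basis (\<lambda>_. lborel :: real measure))"
      by measurable
    have "(\<integral>\<^sup>+x. g x \<partial>lborel) = (\<integral>\<^sup>+x. g (\<Sum>b\<in>Basis. x b *\<^sub>R b) \<partial>Pi\<^sub>M Basis (\<lambda>_. lborel))"
      by (subst lborel_eq) (simp add: nn_integral_distr)
    also have "\<dots> = (\<integral>\<^sup>+x. \<integral>\<^sup>+y. g (\<Sum>b\<in>Basis. (x(i := y)) b *\<^sub>R b) \<partial>lborel \<partial>Pi\<^sub>M (Basis - {i}) (\<lambda>_. lborel))"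
      using product_nn_integral_insert[of "Basis - {i}" i "\<lambda>x. g (\<Sum>b\<in>Basis. x b *\<^sub>R b)"] m
      unfolding B[symmetric] by simp
    finally show ?thesis by (simp only: sum_eq)
  qed
  let ?s = "\<lambda>x. \<Sum>b\<in>Basis - {i}. x b *\<^sub>R b"
  have "(\<integral>\<^sup>+y. f ((?s x + y *\<^sub>R i) + (c * ((?s x + y *\<^sub>R i) \<bullet> j)) *\<^sub>R i) \<partial>lborel)
      = (\<integral>\<^sup>+y. f (?s x + y *\<^sub>R i) \<partial>lborel)" for x
  proof -
    have "(\<integral>\<^sup>+y. f ((?s x + y *\<^sub>R i) + (c * ((?s x + y *\<^sub>R i) \<bullet> j)) *\<^sub>R i) \<partial>lborel)
        = (\<integral>\<^sup>+y. f (?s x + (c * (?s x \<bullet> j) + y) *\<^sub>R i) \<partial>lborel)"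
      using ij by (simp add: inner_add_left inner_not_same_Basis algebra_simps)
    also have "\<dots> = (\<integral>\<^sup>+y. f (?s x + y *\<^sub>R i) \<partial>lborel)"
      by (rule nn_integral_lborel_translate) measurable
    finally show ?thesis .
  qed
  then show ?thesis
    by (simp add: eq)
qed

text \<open>The library's linear change of variables requires a well-ordered index type.\<close>

lemma nn_integral_lborel_matrix:
  fixes A :: "real^'n^'n" and f :: "real^'n \<Rightarrow> ennreal"
  assumes "f \<in> borel_measurable borel" "det A \<noteq> 0"
  shows "ennreal \<bar>det A\<bar> * (\<integral>\<^sup>+x. f (A *v x) \<partial>lborel) = (\<integral>\<^sup>+x. f x \<partial>lborel)"
proof -
  have meas: "(\<lambda>x. A *v x) \<in> borel_measurable borel" for A :: "real^'n^'n"
    by (intro borel_measurable_continuous_onI matrix_vector_mult_linear_continuous_on)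
  \<comment> \<open>\<open>f\<close> is quantified inside the induction because the row operation
    step applies the hypothesis to \<open>f\<close> composed with a shear.\<close>
  have "\<forall>f\<in>borel_measurable borel. det A \<noteq> 0 \<longrightarrow>
      ennreal \<bar>det A\<bar> * (\<integral>\<^sup>+x. f (A *v x) \<partial>lborel) = (\<integral>\<^sup>+x. f x \<partial>lborel)"
  proof (induction A rule: induct_matrix_row_operations)
    case (1 A i)
    then show ?case by (metis det_zero_row(2))
  next
    case (2 A)
    show ?case
    proof (intro ballI impI)
      fix f :: "real^'n \<Rightarrow> ennreal"
      assume [measurable]: "f \<in> borel_measurable borel" and "det A \<noteq> 0"
      have det: "det A = (\<Prod>i\<in>UNIV. A $ i $ i)" using det_diagonal[of A] 2 by simp
      \<comment> \<open>The diagonal entries, indexed by basis vectors as in the coordinatewise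
        scaling rule \<open>lborel_affine_euclidean\<close>.\<close>
      define c :: "real^'n \<Rightarrow> real" where "c = (\<lambda>b. b \<bullet> (A *v b))"
      have c_axis: "c (axis i 1) = A $ i $ i" for i
        by (simp add: c_def matrix_vector_mult_basis column_def inner_axis')
      have Av: "(A *v x) $ i = A $ i $ i * x $ i" for x i
        using 2 by (simp add: matrix_vector_mult_def)
          (subst sum.remove[of _ i], auto intro!: sum.neutral)
      have bij: "bij_betw (\<lambda>i::'n. axis i 1) UNIV (Basis :: (real^'n) set)"
        by (auto simp: bij_betw_def inj_on_def axis_eq_axis Basis_vec_def)
      have T: "0 + (\<Sum>b\<in>Basis. (c b * (x \<bullet> b)) *\<^sub>R b) = A *v x" for x
        unfolding sum.reindex_bij_betw[OF bij, symmetric]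
        by (simp add: vec_eq_iff c_axis Av inner_axis) (simp add: axis_def if_distrib cong: if_cong)
      have pr: "(\<Prod>b\<in>Basis. \<bar>c b\<bar>) = \<bar>det A\<bar>"
        unfolding prod.reindex_bij_betw[OF bij, symmetric] by (simp add: c_axis det abs_prod)
      have nz: "c b \<noteq> 0" if "b \<in> Basis" for b
        using that \<open>det A \<noteq> 0\<close> det by (auto simp: Basis_vec_def c_axis)
      have "lborel = density (distr lborel borel ((*v) A)) (\<lambda>_. ennreal \<bar>det A\<bar>)"
        using lborel_affine_euclidean[of c 0] nz unfolding T pr by blast
      then have "(\<integral>\<^sup>+x. f x \<partial>lborel) = (\<integral>\<^sup>+x. f x \<partial>density (distr lborel borel ((*v) A)) (\<lambda>_. ennreal \<bar>det A\<bar>))"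
        by simp
      also have "\<dots> = ennreal \<bar>det A\<bar> * (\<integral>\<^sup>+x. f (A *v x) \<partial>lborel)"
        using meas[of A] by (simp add: nn_integral_density nn_integral_distr nn_integral_cmult)
      finally show "ennreal \<bar>det A\<bar> * (\<integral>\<^sup>+x. f (A *v x) \<partial>lborel) = (\<integral>\<^sup>+x. f x \<partial>lborel)" ..
    qed
  next
    case (3 A m n)
    let ?\<tau> = "Transposition.transpose m n"
    let ?A = "\<chi> i j. A $ i $ ?\<tau> j"
    let ?T = "\<lambda>x::real^'n. \<chi> i. x $ ?\<tau> i"
    have perm: "?\<tau> permutes UNIV" by (rule permutes_swap_id) auto
    have det: "\<bar>det ?A\<bar> = \<bar>det A\<bar>"
      by (simp add: det_permute_columns[OF perm] abs_mult sign_def)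
    \<comment> \<open>Swapping two columns of the matrix amounts to swapping two coordinates of the
      argument first, which preserves Lebesgue measure.\<close>
    have mult: "?A *v x = A *v ?T x" for x
    proof -
      have "(\<Sum>j\<in>UNIV. A $ i $ ?\<tau> j * x $ j) = (\<Sum>j\<in>UNIV. A $ i $ j * x $ ?\<tau> j)" for i
        using sum.permute[OF perm, of "\<lambda>j. A $ i $ j * x $ ?\<tau> j"] by (simp add: o_def)
      then show ?thesis by (simp add: vec_eq_iff matrix_vector_mult_def)
    qed
    have T: "distr lborel borel ?T = lborel"
    proof (rule lborel_distr_basis_permutation)
      show "bij_betw ?T Basis Basis"
      proof (rule bij_betw_byWitness[where f' = ?T])
        have "?T (axis i 1) = axis (?\<tau> i) 1" for i
          by (auto simp: vec_eq_iff axis_def)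
        then show "?T ` Basis \<subseteq> Basis" "?T ` Basis \<subseteq> Basis"
          by (auto simp: Basis_vec_def)
      qed (auto simp: vec_eq_iff)
      show "?T x \<bullet> b = x \<bullet> ?T b" for x b
        unfolding inner_vec_def
        using sum.permute[OF perm, of "\<lambda>j. x $ ?\<tau> j \<bullet> b $ j"] by (simp add: o_def)
      show "?T \<in> borel_measurable borel"
        by (intro borel_measurable_continuous_onI continuous_intros)
    qed
    show ?case
    proof (intro ballI impI)
      fix f :: "real^'n \<Rightarrow> ennreal"
      assume f [measurable]: "f \<in> borel_measurable borel" and "det ?A \<noteq> 0"
      have mT: "?T \<in> borel_measurable borel"
        by (intro borel_measurable_continuous_onI continuous_intros)
      have "(\<integral>\<^sup>+x. f (?A *v x) \<partial>lborel) = (\<integral>\<^sup>+x. f (A *v x) \<partial>distr lborel borel ?T)"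
        using meas[of A] mT by (simp add: nn_integral_distr mult)
      then show "ennreal \<bar>det ?A\<bar> * (\<integral>\<^sup>+x. f (?A *v x) \<partial>lborel) = (\<integral>\<^sup>+x. f x \<partial>lborel)"
        using 3 f det \<open>det ?A \<noteq> 0\<close> T by auto
    qed
  next
    case (4 A m n c)
    let ?A = "\<chi> i. if i = m then row m A + c *\<^sub>R row n A else row i A"
    \<comment> \<open>Adding \<open>c\<close> times row \<open>n\<close> to row \<open>m\<close> is
      this shear applied after \<open>A\<close>; it changes neither the determinant nor Lebesgue
      integrals.\<close>
    let ?S = "\<lambda>y::real^'n. y + (c * (y \<bullet> axis n 1)) *\<^sub>R axis m 1"
    have det: "det ?A = det A"
      using det_row_operation[OF \<open>m \<noteq> n\<close>, of A c] unfolding scalar_mult_eq_scaleR .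
    have mult: "?A *v x = ?S (A *v x)" for x
      by (simp add: vec_eq_iff matrix_vector_mult_def row_def inner_axis sum.distrib
          sum_distrib_left algebra_simps) (simp add: axis_def)
    show ?case
    proof (intro ballI impI)
      fix f :: "real^'n \<Rightarrow> ennreal"
      assume f [measurable]: "f \<in> borel_measurable borel" and "det ?A \<noteq> 0"
      have "(\<lambda>y. f (?S y)) \<in> borel_measurable borel" by measurable
      then have "ennreal \<bar>det A\<bar> * (\<integral>\<^sup>+x. f (?S (A *v x)) \<partial>lborel) = (\<integral>\<^sup>+x. f (?S x) \<partial>lborel)"
        using 4 \<open>det ?A \<noteq> 0\<close> det by auto
      also have "\<dots> = (\<integral>\<^sup>+x. f x \<partial>lborel)"
        by (rule nn_integral_lborel_shear) (use \<open>m \<noteq> n\<close> in \<open>auto simp: axis_eq_axis\<close>)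
      finally show "ennreal \<bar>det ?A\<bar> * (\<integral>\<^sup>+x. f (?A *v x) \<partial>lborel) = (\<integral>\<^sup>+x. f x \<partial>lborel)"
        by (simp only: mult det)
    qed
  qed
  with assms show ?thesis by blast
qed

section \<open>Gaussian integrals, from one dimension to a positive definite form\<close>

lemma nn_integral_gaussian_1:
  "(\<integral>\<^sup>+t. ennreal (exp (- (1/2) * t\<^sup>2)) \<partial>lborel) = ennreal (sqrt (2 * pi))"
proof -
  have "(\<integral>\<^sup>+t. ennreal (exp (- (1/2) * t\<^sup>2)) \<partial>lborel)
      = (\<integral>\<^sup>+t. ennreal (sqrt (2 * pi)) * ennreal (std_normal_density t) \<partial>lborel)"
    by (intro nn_integral_cong) (simp add: std_normal_density_def flip: ennreal_mult)
  also have "\<dots> = ennreal (sqrt (2 * pi))"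
    by (simp add: nn_integral_cmult nn_integral_eq_integral)
  finally show ?thesis .
qed

lemma nn_integral_gaussian_identity:
  "(\<integral>\<^sup>+(x::real^'n). ennreal (exp (- (1/2) * (x \<bullet> x))) \<partial>lborel) = ennreal (sqrt ((2 * pi) ^ CARD('n)))"
proof -
  have "ennreal (exp (- (1/2) * (x \<bullet> x))) = (\<Prod>b\<in>Basis. ennreal (exp (- (1/2) * (x \<bullet> b)\<^sup>2)))" for x :: "real^'n"
    by (subst euclidean_inner) (simp add: sum_distrib_left exp_sum prod_ennreal power2_eq_square sum_divide_distrib flip: sum_negf)
  then have "(\<integral>\<^sup>+(x::real^'n). ennreal (exp (- (1/2) * (x \<bullet> x))) \<partial>lborel)
      = (\<Prod>b\<in>(Basis :: (real^'n) set). \<integral>\<^sup>+t. ennreal (exp (- (1/2) * t\<^sup>2)) \<partial>lborel)"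
    by (simp only:) (rule nn_integral_lborel_prod; simp)
  then show ?thesis
    by (simp only: nn_integral_gaussian_1) (simp add: ennreal_power real_sqrt_power real_sqrt_mult power_mult_distrib)
qed

text \<open>Determinants of the congruence give \<open>(det E)\<^sup>2 * det A = 1\<close>.\<close>

lemma pos_def_matrix_det_pos:
  fixes A :: "real^'n^'n"
  assumes "pos_def_matrix A"
  shows "det A > 0"
proof -
  obtain E :: "real^'n^'n" where "transpose E ** A ** E = mat 1"
    using assms by (rule pos_def_matrix_orthonormal_basis)
  then have "det E * det A * det E = 1"
    by (metis det_I det_mul det_transpose)
  then have "(det E)\<^sup>2 * det A = 1" by (simp add: power2_eq_square mult_ac)
  then show ?thesis
    by (metis zero_le_power2 zero_less_mult_pos zero_less_one less_eq_real_def mult_zero_left)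
qed

text \<open>Substituting x = E y turns the form into y . y, and the Jacobian |det E| supplies the
  factor 1 / sqrt (det A).\<close>

lemma nn_integral_gaussian:
  fixes A :: "real^'n^'n"
  assumes A: "pos_def_matrix A"
  shows "(\<integral>\<^sup>+x. ennreal (exp (- (1/2) * (x \<bullet> (A *v x)))) \<partial>lborel) = ennreal (sqrt ((2 * pi) ^ CARD('n) / det A))"
proof -
  obtain E :: "real^'n^'n" where E: "transpose E ** A ** E = mat 1"
    using assms by (rule pos_def_matrix_orthonormal_basis)
  then have "det E * det A * det E = 1"
    by (metis det_I det_mul det_transpose)
  then have d: "(det E)\<^sup>2 * det A = 1" by (simp add: power2_eq_square mult_ac)
  then have nz: "det E \<noteq> 0" by auto
  have dA: "det A > 0" using A by (rule pos_def_matrix_det_pos)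
  have dE: "\<bar>det E\<bar> = 1 / sqrt (det A)"
    using d dA by (metis eq_divide_eq less_irrefl real_sqrt_abs real_sqrt_divide real_sqrt_one)
  have [measurable]: "(\<lambda>x. A *v x) \<in> borel_measurable borel"
    by (intro borel_measurable_continuous_onI matrix_vector_mult_linear_continuous_on)
  have Ex: "(E *v x) \<bullet> (A *v (E *v x)) = x \<bullet> x" for x
  proof -
    have "(E *v x) \<bullet> (A *v (E *v x)) = x \<bullet> (transpose E *v (A *v (E *v x)))"
      by (simp only: inner_transpose_matrix_vector)
    also have "\<dots> = x \<bullet> ((transpose E ** A ** E) *v x)"
      by (simp only: matrix_vector_mul_assoc matrix_mul_assoc)
    finally show ?thesis by (simp add: E)
  qed
  have "(\<integral>\<^sup>+x. ennreal (exp (- (1/2) * (x \<bullet> (A *v x)))) \<partial>lborel)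
     = ennreal \<bar>det E\<bar> * (\<integral>\<^sup>+x. ennreal (exp (- (1/2) * ((E *v x) \<bullet> (A *v (E *v x))))) \<partial>lborel)"
    by (rule nn_integral_lborel_matrix[OF _ nz, symmetric]) measurable
  also have "\<dots> = ennreal \<bar>det E\<bar> * ennreal (sqrt ((2 * pi) ^ CARD('n)))"
    unfolding Ex nn_integral_gaussian_identity ..
  also have "\<dots> = ennreal (sqrt ((2 * pi) ^ CARD('n) / det A))"
    using dA by (simp add: dE real_sqrt_divide flip: ennreal_mult)
  finally show ?thesis .
qed

section \<open>Gaussian measures\<close>

lemma borel_measurable_matrix_vector_mult [measurable (raw)]:
  fixes A :: "real^'n^'m"
  assumes "f \<in> borel_measurable M"
  shows "(\<lambda>x. A *v f x) \<in> borel_measurable M"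
  using assms by (rule borel_measurable_continuous_on[rotated])
    (rule matrix_vector_mult_linear_continuous_on)

text \<open>The real density inside \<open>gaussian\<close>, kept apart from \<open>ennreal\<close>
  so that densities can be factored and divided as real numbers.\<close>

definition gaussian_density :: "real^'n \<Rightarrow> real^'n^'n \<Rightarrow> real^'n \<Rightarrow> real" where
  "gaussian_density m S x =
     exp (- (1/2) * ((x - m) \<bullet> (matrix_inv S *v (x - m)))) / sqrt ((2 * pi) ^ CARD('n) * det S)"

lemma gaussian_eq_density: "gaussian m S = density lborel (\<lambda>x. ennreal (gaussian_density m S x))"
  by (simp add: gaussian_def gaussian_density_def)

lemma borel_measurable_gaussian_density [measurable (raw)]:
  assumes [measurable]: "f \<in> borel_measurable M" "g \<in> borel_measurable M"
  shows "(\<lambda>x. gaussian_density (f x) S (g x)) \<in> borel_measurable M"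
  unfolding gaussian_density_def by measurable

lemma gaussian_density_pos:
  assumes "pos_def_matrix S"
  shows "0 < gaussian_density m S x"
  using pos_def_matrix_det_pos[OF assms] by (simp add: gaussian_density_def)

lemma nn_integral_gaussian_density:
  fixes S :: "real^'n^'n"
  assumes S: "pos_def_matrix S"
  shows "(\<integral>\<^sup>+x. ennreal (gaussian_density m S x) \<partial>lborel) = 1"
proof -
  have d: "det S > 0" using S by (rule pos_def_matrix_det_pos)
  have "det S * det (matrix_inv S) = 1"
    by (metis S det_I det_mul matrix_inv_right pos_def_matrix_invertible)
  then have di: "det (matrix_inv S) = 1 / det S" using d by (simp add: field_simps)
  define c where "c = sqrt ((2 * pi) ^ CARD('n) * det S)"
  have c: "c > 0" using d by (simp add: c_def)
  have "(\<integral>\<^sup>+x. ennreal (gaussian_density m S x) \<partial>lborel) = (\<integral>\<^sup>+x. ennreal (gaussian_density m S (m + x)) \<partial>lborel)"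
    by (rule nn_integral_lborel_translate[symmetric]) measurable
  also have "\<dots> = (\<integral>\<^sup>+x. ennreal (exp (- (1/2) * (x \<bullet> (matrix_inv S *v x)))) * ennreal (1 / c) \<partial>lborel)"
    unfolding gaussian_density_def c_def[symmetric] using c
    by (intro nn_integral_cong) (simp flip: ennreal_mult)
  also have "\<dots> = (\<integral>\<^sup>+x. ennreal (exp (- (1/2) * (x \<bullet> (matrix_inv S *v x)))) \<partial>lborel) * ennreal (1 / c)"
    by (rule nn_integral_multc) measurable
  also have "\<dots> = ennreal c * ennreal (1 / c)"
    unfolding nn_integral_gaussian[OF pos_def_matrix_inv[OF S]] by (simp add: di c_def)
  also have "\<dots> = 1" using c by (simp flip: ennreal_mult)
  finally show ?thesis .
qed

lemma prob_space_gaussian: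
  assumes "pos_def_matrix S"
  shows "prob_space (gaussian m S)"
  by (rule prob_spaceI) (simp add: gaussian_eq_density emeasure_density nn_integral_gaussian_density[OF assms])

lemma sets_gaussian [simp, measurable_cong]: "sets (gaussian m S) = sets borel"
  and space_gaussian [simp]: "space (gaussian m S) = UNIV"
  by (simp_all add: gaussian_def)

lemma pos_def_matrix_scaleR:
  assumes "pos_def_matrix A" "0 < c"
  shows "pos_def_matrix (c *\<^sub>R A)"
  using assms by (simp add: pos_def_matrix_def transpose_scalar scaleR_matrix_vector_assoc[symmetric])

lemma pos_def_matrix_mat_1: "pos_def_matrix (mat 1 :: real^'n^'n)"
  by (simp add: pos_def_matrix_def)

lemma nn_integral_exp_norm_finite:
  assumes "c > 0"
  shows "(\<integral>\<^sup>+(x::real^'n). ennreal (exp (- c * (norm x)\<^sup>2)) \<partial>lborel) < \<infinity>"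
proof -
  have "x \<bullet> ((2 * c) *\<^sub>R mat 1 *v x) = 2 * c * (norm x)\<^sup>2" for x :: "real^'n"
    by (simp add: power2_norm_eq_inner flip: scaleR_matrix_vector_assoc)
  then show ?thesis
    using nn_integral_gaussian[where A = "(2 * c) *\<^sub>R mat 1 :: real^'n^'n"] assms
    by (simp add: pos_def_matrix_scaleR pos_def_matrix_mat_1)
qed

lemma integrable_gaussian_norm_sq:
  fixes S :: "real^'n^'n"
  assumes S: "pos_def_matrix S"
  shows "integrable (gaussian 0 S) (\<lambda>x. (norm x)\<^sup>2)"
proof -
  obtain c where c: "c > 0" "\<And>x. c * (norm x)\<^sup>2 \<le> x \<bullet> (matrix_inv S *v x)"
    using pos_def_matrix_lower_bound[OF pos_def_matrix_inv[OF S]] by metis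
  define k where "k = sqrt ((2 * pi) ^ CARD('n) * det S)"
  have k: "k > 0" using pos_def_matrix_det_pos[OF S] by (simp add: k_def)
  \<comment> \<open>The density decays like exp (-(c/2) |x|^2). Half of that rate absorbs the factor
    |x|^2, by t <= exp t at t = (c/4) |x|^2; the other half stays integrable.\<close>
  have bound: "gaussian_density 0 S x * (norm x)\<^sup>2 \<le> 4 / (c * k) * exp (- (c/4) * (norm x)\<^sup>2)" for x :: "real^'n"
  proof -
    have "c/4 * (norm x)\<^sup>2 \<le> exp (c/4 * (norm x)\<^sup>2)"
      using exp_ge_add_one_self[of "c/4 * (norm x)\<^sup>2"] by linarith
    then have 1: "(norm x)\<^sup>2 \<le> 4 / c * exp (c/4 * (norm x)\<^sup>2)"
      using c(1) by (simp add: field_simps)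
    have 2: "gaussian_density 0 S x \<le> exp (- (c/2) * (norm x)\<^sup>2) / k"
      using c(2)[of x] k unfolding gaussian_density_def k_def[symmetric] by (intro divide_right_mono) auto
    have "gaussian_density 0 S x * (norm x)\<^sup>2 \<le> exp (- (c/2) * (norm x)\<^sup>2) / k * (4 / c * exp (c/4 * (norm x)\<^sup>2))"
      by (intro mult_mono 1 2) (use k in auto)
    also have "\<dots> = 4 / (c * k) * (exp (- (c/2) * (norm x)\<^sup>2) * exp (c/4 * (norm x)\<^sup>2))"
      by (simp add: mult_ac)
    also have "exp (- (c/2) * (norm x)\<^sup>2) * exp (c/4 * (norm x)\<^sup>2) = exp (- (c/4) * (norm x)\<^sup>2)"
      by (simp flip: exp_add)
    finally show ?thesis .
  qed
  have "(\<integral>\<^sup>+x. ennreal (norm ((norm x)\<^sup>2)) \<partial>gaussian 0 S) = (\<integral>\<^sup>+x. ennreal (gaussian_density 0 S x * (norm x)\<^sup>2) \<partial>lborel)"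
    unfolding gaussian_eq_density
    by (subst nn_integral_density) (auto simp: ennreal_mult gaussian_density_pos[OF S] less_imp_le intro!: nn_integral_cong)
  also have "\<dots> \<le> (\<integral>\<^sup>+(x::real^'n). ennreal (4 / (c * k)) * ennreal (exp (- (c/4) * (norm x)\<^sup>2)) \<partial>lborel)"
  proof (rule nn_integral_mono)
    show "ennreal (gaussian_density 0 S x * (norm x)\<^sup>2) \<le> ennreal (4 / (c * k)) * ennreal (exp (- (c/4) * (norm x)\<^sup>2))" for x
      using bound[of x] c(1) k by (subst ennreal_mult[symmetric]) (auto intro: ennreal_leI)
  qed
  also have "\<dots> = ennreal (4 / (c * k)) * (\<integral>\<^sup>+(x::real^'n). ennreal (exp (- (c/4) * (norm x)\<^sup>2)) \<partial>lborel)"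
    by (rule nn_integral_cmult) measurable
  also have "\<dots> < \<infinity>"
    using nn_integral_exp_norm_finite[of "c/4", where 'n = 'n] c by (simp add: ennreal_mult_less_top)
  finally show ?thesis
    by (intro integrableI_bounded) auto
qed

section \<open>Marginals and conditionals of densities on a product\<close>

context pair_sigma_finite
begin

text \<open>\<open>k\<close> is a conditional density in \<open>x\<close> given \<open>y\<close>, so
  by Tonelli it integrates out and leaves \<open>h\<close>.\<close>

lemma distr_density_snd:
  assumes [measurable]: "h \<in> borel_measurable M2" "(\<lambda>(x, y). k x y) \<in> borel_measurable (M1 \<Otimes>\<^sub>M M2)"
    and k: "\<And>y. y \<in> space M2 \<Longrightarrow> (\<integral>\<^sup>+x. k x y \<partial>M1) = 1"
    and N: "sets N = sets M2"
  shows "distr (density (M1 \<Otimes>\<^sub>M M2) (\<lambda>(x, y). h y * k x y)) N snd = density M2 h"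
proof (rule measure_eqI)
  fix A assume "A \<in> sets (distr (density (M1 \<Otimes>\<^sub>M M2) (\<lambda>(x, y). h y * k x y)) N snd)"
  then have [measurable]: "A \<in> sets M2" using N by simp
  have "snd \<in> density (M1 \<Otimes>\<^sub>M M2) (\<lambda>(x, y). h y * k x y) \<rightarrow>\<^sub>M N"
    using N by (simp add: measurable_cong_sets[OF _ N])
  then have "emeasure (distr (density (M1 \<Otimes>\<^sub>M M2) (\<lambda>(x, y). h y * k x y)) N snd) A
      = (\<integral>\<^sup>+p. (case p of (x, y) \<Rightarrow> h y * k x y) * indicator (snd -` A \<inter> space (M1 \<Otimes>\<^sub>M M2)) p \<partial>(M1 \<Otimes>\<^sub>M M2))"
    using N by (subst emeasure_distr) (auto simp: emeasure_density)
  also have "\<dots> = (\<integral>\<^sup>+p. (case p of (x, y) \<Rightarrow> (h y * indicator A y) * k x y) \<partial>(M1 \<Otimes>\<^sub>M M2))"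
    by (intro nn_integral_cong) (auto simp: indicator_def)
  also have "\<dots> = (\<integral>\<^sup>+y. \<integral>\<^sup>+x. (h y * indicator A y) * k x y \<partial>M1 \<partial>M2)"
    by (subst nn_integral_snd[symmetric]) auto
  also have "\<dots> = (\<integral>\<^sup>+y. h y * indicator A y \<partial>M2)"
    by (intro nn_integral_cong) (simp add: nn_integral_cmult k)
  finally show "emeasure (distr (density (M1 \<Otimes>\<^sub>M M2) (\<lambda>(x, y). h y * k x y)) N snd) A = emeasure (density M2 h) A"
    by (simp add: emeasure_density)
qed (simp add: N)

lemma distr_density_fst:
  assumes [measurable]: "h \<in> borel_measurable M1" "(\<lambda>(x, y). k x y) \<in> borel_measurable (M1 \<Otimes>\<^sub>M M2)"
    and k: "\<And>x. x \<in> space M1 \<Longrightarrow> (\<integral>\<^sup>+y. k x y \<partial>M2) = 1"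
    and N: "sets N = sets M1"
  shows "distr (density (M1 \<Otimes>\<^sub>M M2) (\<lambda>(x, y). h x * k x y)) N fst = density M1 h"
proof (rule measure_eqI)
  fix A assume "A \<in> sets (distr (density (M1 \<Otimes>\<^sub>M M2) (\<lambda>(x, y). h x * k x y)) N fst)"
  then have [measurable]: "A \<in> sets M1" using N by simp
  have "fst \<in> density (M1 \<Otimes>\<^sub>M M2) (\<lambda>(x, y). h x * k x y) \<rightarrow>\<^sub>M N"
    using N by (simp add: measurable_cong_sets[OF _ N])
  then have "emeasure (distr (density (M1 \<Otimes>\<^sub>M M2) (\<lambda>(x, y). h x * k x y)) N fst) A
      = (\<integral>\<^sup>+p. (case p of (x, y) \<Rightarrow> h x * k x y) * indicator (fst -` A \<inter> space (M1 \<Otimes>\<^sub>M M2)) p \<partial>(M1 \<Otimes>\<^sub>M M2))"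
    using N by (subst emeasure_distr) (auto simp: emeasure_density)
  also have "\<dots> = (\<integral>\<^sup>+p. (case p of (x, y) \<Rightarrow> (h x * indicator A x) * k x y) \<partial>(M1 \<Otimes>\<^sub>M M2))"
    by (intro nn_integral_cong) (auto simp: indicator_def)
  also have "\<dots> = (\<integral>\<^sup>+x. \<integral>\<^sup>+y. (h x * indicator A x) * k x y \<partial>M2 \<partial>M1)"
    by (subst M2.nn_integral_fst[symmetric]) auto
  also have "\<dots> = (\<integral>\<^sup>+x. h x * indicator A x \<partial>M1)"
    by (intro nn_integral_cong) (simp add: nn_integral_cmult k)
  finally show "emeasure (distr (density (M1 \<Otimes>\<^sub>M M2) (\<lambda>(x, y). h x * k x y)) N fst) A = emeasure (density M1 h) A"
    by (simp add: emeasure_density)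
qed (simp add: N)

end

text \<open>A joint density that factors as (function of y) times (probability density in x given y)
  displays its own conditional. The reference measures are left general: Lebesgue measure serves for
  \<open>joint_gaussian\<close>, the Gaussian marginals for \<open>model_joint\<close>.\<close>

lemma is_conditional_density:
  fixes M1 :: "'a::second_countable_topology measure" and M2 :: "'b::second_countable_topology measure"
  assumes "sigma_finite_measure M1" "sigma_finite_measure M2"
    and sets1 [measurable_cong]: "sets M1 = sets borel" and sets2 [measurable_cong]: "sets M2 = sets borel"
    and [measurable]: "h \<in> borel_measurable borel" "(\<lambda>(x, y). k x y) \<in> borel_measurable (borel \<Otimes>\<^sub>M borel)"
    and k: "\<And>y. (\<integral>\<^sup>+x. k x y \<partial>M1) = 1"
  shows "is_conditional_u_given_v (density (M1 \<Otimes>\<^sub>M M2) (\<lambda>(x, y). h y * k x y)) (\<lambda>y. density M1 (\<lambda>x. k x y))"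
proof -
  interpret M1: sigma_finite_measure M1 by fact
  interpret M2: sigma_finite_measure M2 by fact
  interpret pair_sigma_finite M1 M2 ..
  have sp1: "space M1 = UNIV" using sets_eq_imp_space_eq[OF sets1] by simp
  have [measurable]: "(\<lambda>x. k x y) \<in> borel_measurable borel" for y by measurable
  have marg: "marginal_v (density (M1 \<Otimes>\<^sub>M M2) (\<lambda>(x, y). h y * k x y)) = density M2 h"
    unfolding marginal_v_def by (rule distr_density_snd) (use sets2 k in auto)
  have em: "emeasure (density M1 (\<lambda>x. k x y)) S = (\<integral>\<^sup>+x. k x y * indicator S x \<partial>M1)"
    if "S \<in> sets borel" for S y
    using that by (subst emeasure_density) (auto simp: sets1)
  have kernel: "(\<lambda>y. density M1 (\<lambda>x. k x y)) \<in> borel \<rightarrow>\<^sub>M prob_algebra borel"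
  proof (rule measurable_prob_algebraI)
    show prob: "prob_space (density M1 (\<lambda>x. k x y))" for y
      by (rule prob_spaceI) (use em[of UNIV y] k[of y] in \<open>simp add: sp1\<close>)
    show "(\<lambda>y. density M1 (\<lambda>x. k x y)) \<in> borel \<rightarrow>\<^sub>M subprob_algebra borel"
    proof (rule measurable_subprob_algebra)
      show "subprob_space (density M1 (\<lambda>x. k x y))" for y
        using prob by (rule prob_space_imp_subprob_space)
      fix S :: "'a set" assume [measurable]: "S \<in> sets borel"
      show "(\<lambda>y. emeasure (density M1 (\<lambda>x. k x y)) S) \<in> borel_measurable borel"
        by (simp add: em)
    qed (simp add: sets1)
  qed
  have "emeasure (density (M1 \<Otimes>\<^sub>M M2) (\<lambda>(x, y). h y * k x y)) (S \<times> T)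
      = (\<integral>\<^sup>+ v \<in> T. emeasure (density M1 (\<lambda>x. k x v)) S \<partial>density M2 h)"
    if [measurable]: "S \<in> sets borel" "T \<in> sets borel" for S T
  proof -
    have "emeasure (density (M1 \<Otimes>\<^sub>M M2) (\<lambda>(x, y). h y * k x y)) (S \<times> T)
        = (\<integral>\<^sup>+p. (case p of (x, y) \<Rightarrow> (h y * indicator T y) * (k x y * indicator S x)) \<partial>(M1 \<Otimes>\<^sub>M M2))"
      by (subst emeasure_density) (auto intro!: nn_integral_cong simp: indicator_def)
    also have "\<dots> = (\<integral>\<^sup>+y. \<integral>\<^sup>+x. (h y * indicator T y) * (k x y * indicator S x) \<partial>M1 \<partial>M2)"
      by (subst nn_integral_snd[symmetric]) auto
    also have "\<dots> = (\<integral>\<^sup>+y. h y * (emeasure (density M1 (\<lambda>x. k x y)) S * indicator T y) \<partial>M2)"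
      by (intro nn_integral_cong, simp add: nn_integral_cmult em, simp add: mult_ac)
    also have "\<dots> = (\<integral>\<^sup>+ v \<in> T. emeasure (density M1 (\<lambda>x. k x v)) S \<partial>density M2 h)"
      by (subst nn_integral_density) (auto simp: em)
    finally show ?thesis .
  qed
  with kernel show ?thesis
    by (simp add: is_conditional_u_given_v_def marg)
qed

section \<open>Block decomposition of a joint covariance\<close>

lemma transpose_diff: "transpose (A - B :: 'a::ab_group_add^'n^'m) = transpose A - transpose B"
  by (simp add: transpose_def vec_eq_iff)

lemma matrix_vector_mult_uminus: "A *v (- x) = - (A *v (x :: real^'n))"
  using matrix_vector_mult_diff_distrib[of A 0 x] by simp

text \<open>Block elimination for a symmetric matrix with blocks P, Q, transpose Q, R. If (a, b)
  solves the block system with right side (u, v), then u . a + v . b is the inverse quadratic form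
  at (u, v), so the last claim is the completed square without an explicit block inverse. Generic
  blocks allow both orders of elimination.\<close>

lemma pos_def_schur_complement:
  fixes P :: "real^'a^'a" and Q :: "real^'b^'a" and R :: "real^'b^'b"
  assumes sym: "transpose P = P" "transpose R = R"
    and pos: "\<And>a b. a \<noteq> 0 \<or> b \<noteq> 0 \<Longrightarrow> 0 < a \<bullet> (P *v a + Q *v b) + b \<bullet> (transpose Q *v a + R *v b)"
  defines "S \<equiv> P - Q ** matrix_inv R ** transpose Q"
  shows "pos_def_matrix P" "pos_def_matrix R"
    "pos_def_matrix S"
    "P *v a + Q *v b = u \<Longrightarrow> transpose Q *v a + R *v b = v \<Longrightarrow> u \<bullet> a + v \<bullet> b
      = (u - Q ** matrix_inv R *v v) \<bullet> (matrix_inv S *v (u - Q ** matrix_inv R *v v))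
        + v \<bullet> (matrix_inv R *v v)"
proof -
  show P: "pos_def_matrix P"
    using pos[of _ 0] sym by (simp add: pos_def_matrix_def)
  show R: "pos_def_matrix R"
    using pos[of 0] sym by (simp add: pos_def_matrix_def)
  have Ri: "invertible R" using R by (rule pos_def_matrix_invertible)
  have trRi: "transpose (matrix_inv R) = matrix_inv R"
    using pos_def_matrix_inv[OF R] by (simp add: pos_def_matrix_def)
  have Sv: "S *v x = P *v x - Q *v (matrix_inv R *v (transpose Q *v x))" for x
    by (simp add: S_def matrix_vector_mult_diff_rdistrib matrix_vector_mul_assoc matrix_mul_assoc del: transpose_matrix_vector)
  have trS: "transpose S = S"
    by (simp add: S_def transpose_diff sym trRi matrix_transpose_mul matrix_mul_assoc)
  have "0 < x \<bullet> (S *v x)" if "x \<noteq> 0" for x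
  proof -
    \<comment> \<open>The test vector (x, -R^-1 Q^T x) kills the second component of the block
      product; what remains is the Schur complement form at \<open>x\<close>.\<close>
    have "0 < x \<bullet> (P *v x + Q *v (- (matrix_inv R *v (transpose Q *v x))))
      + (- (matrix_inv R *v (transpose Q *v x))) \<bullet>
        (transpose Q *v x + R *v (- (matrix_inv R *v (transpose Q *v x))))"
      using that by (intro pos) simp
    then show ?thesis
      by (simp add: Sv matrix_vector_mult_uminus Ri del: transpose_matrix_vector)
  qed
  then show S: "pos_def_matrix S"
    using trS by (simp add: pos_def_matrix_def)
  then have Si: "invertible S" by (rule pos_def_matrix_invertible)
  show "u \<bullet> a + v \<bullet> b = (u - Q ** matrix_inv R *v v) \<bullet> (matrix_inv S *v (u - Q ** matrix_inv R *v v))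
      + v \<bullet> (matrix_inv R *v v)"
    if u: "P *v a + Q *v b = u" and v: "transpose Q *v a + R *v b = v"
  proof -
    \<comment> \<open>Solve the second equation for \<open>b\<close>; inserted into the first, it
      gives u - Q R^-1 v = S a.\<close>
    have b: "b = matrix_inv R *v (v - transpose Q *v a)"
      using Ri by (simp flip: v del: transpose_matrix_vector)
    have w: "u - Q ** matrix_inv R *v v = S *v a"
      unfolding Sv using u[symmetric] b
      by (simp add: matrix_vector_mult_diff_distrib matrix_vector_mul_assoc[symmetric] del: transpose_matrix_vector)
    have "v \<bullet> (matrix_inv R *v (transpose Q *v a)) = (Q ** matrix_inv R *v v) \<bullet> a"
      using inner_matrix_vector_symmetric[OF trRi, of v] inner_transpose_matrix_vector[of _ Q a]
      by (simp add: matrix_vector_mul_assoc[symmetric] inner_transpose_matrix_vector del: transpose_matrix_vector)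
    then have "v \<bullet> b = v \<bullet> (matrix_inv R *v v) - (Q ** matrix_inv R *v v) \<bullet> a"
      unfolding b by (simp add: matrix_vector_mult_diff_distrib inner_diff_right del: transpose_matrix_vector)
    moreover have "matrix_inv S *v (u - Q ** matrix_inv R *v v) = a"
      unfolding w using Si by simp
    ultimately show ?thesis
      by (simp add: inner_diff_left)
  qed
qed

section \<open>Identification of the sum-indexed space with the product space\<close>

definition split_vec :: "real^('u::finite + 'v::finite) \<Rightarrow> (real^'u) \<times> (real^'v)" where
  "split_vec z = (\<chi> i. z $ Inl i, \<chi> j. z $ Inr j)"

definition join_vec :: "(real^'u::finite) \<times> (real^'v::finite) \<Rightarrow> real^('u + 'v)" where
  "join_vec p = (\<chi> k. case k of Inl i \<Rightarrow> fst p $ i | Inr j \<Rightarrow> snd p $ j)"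

lemma split_join_vec [simp]: "split_vec (join_vec p) = p"
  by (simp add: split_vec_def join_vec_def vec_eq_iff prod_eq_iff)

lemma join_split_vec [simp]: "join_vec (split_vec z) = z"
  by (simp add: split_vec_def join_vec_def vec_eq_iff split: sum.split)

lemma sum_UNIV_Plus:
  "(\<Sum>k\<in>(UNIV :: ('u::finite + 'v::finite) set). f k) = (\<Sum>i\<in>UNIV. f (Inl i)) + (\<Sum>j\<in>UNIV. f (Inr j))"
  unfolding UNIV_Plus_UNIV[symmetric] by (subst sum.Plus) auto

lemma inner_split_vec: "split_vec z \<bullet> split_vec w = z \<bullet> w"
  by (simp add: split_vec_def inner_vec_def sum_UNIV_Plus)

lemma split_vec_matrix:
  "split_vec (C *v z) = (C_uu C *v fst (split_vec z) + C_uv C *v snd (split_vec z),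
     C_vu C *v fst (split_vec z) + C_vv C *v snd (split_vec z))"
  by (simp add: split_vec_def matrix_vector_mult_def C_uu_def C_uv_def C_vu_def C_vv_def
      vec_eq_iff sum_UNIV_Plus)

lemma borel_measurable_split_vec [measurable]: "split_vec \<in> borel_measurable borel"
  unfolding split_vec_def by (intro borel_measurable_continuous_onI continuous_intros)

lemma borel_measurable_join_vec [measurable]: "join_vec \<in> borel_measurable borel"
  unfolding join_vec_def
proof (intro borel_measurable_continuous_onI continuous_on_vec_lambda)
  fix k :: "'a + 'b"
  show "continuous_on UNIV (\<lambda>p::(real^'a) \<times> (real^'b). case k of Inl i \<Rightarrow> fst p $ i | Inr j \<Rightarrow> snd p $ j)"
    by (cases k) (auto intro!: continuous_intros)
qed

text \<open>\<open>join_vec\<close> maps basis vectors bijectively to basis vectors and is adjoint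
  to \<open>split_vec\<close>, so this is a relabelling of coordinates.\<close>

lemma distr_lborel_split_vec:
  "distr lborel borel split_vec = (lborel :: ((real^'u::finite) \<times> (real^'v::finite)) measure)"
proof (rule lborel_distr_basis_permutation)
  have J: "join_vec (axis i 1, 0) = axis (Inl i) 1" "join_vec (0, axis j 1) = axis (Inr j) 1" for i :: 'u and j :: 'v
    by (auto simp: join_vec_def vec_eq_iff axis_def split: sum.split)
  then have S: "split_vec (axis (Inl i) 1) = (axis i 1, 0)" "split_vec (axis (Inr j) 1) = (0, axis j 1)" for i :: 'u and j :: 'v
    by (metis split_join_vec)+
  show "bij_betw join_vec (Basis :: ((real^'u) \<times> (real^'v)) set) Basis"
  proof (rule bij_betw_byWitness[where f' = split_vec])
    show "join_vec ` (Basis :: ((real^'u) \<times> (real^'v)) set) \<subseteq> Basis"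
      by (auto simp: Basis_prod_def Basis_vec_def J)
    have "split_vec (axis k 1) \<in> Basis" for k :: "'u + 'v"
      by (cases k) (auto simp: Basis_prod_def Basis_vec_def S)
    then show "split_vec ` Basis \<subseteq> (Basis :: ((real^'u) \<times> (real^'v)) set)"
      by (auto simp: Basis_vec_def)
  qed auto
  show "split_vec z \<bullet> p = z \<bullet> join_vec p" for z and p :: "(real^'u) \<times> (real^'v)"
    using inner_split_vec[of z "join_vec p"] by simp
qed measurable

section \<open>Blocks, Schur complements and density of the joint Gaussian\<close>

locale joint_covariance =
  fixes C :: "real^('u::finite + 'v::finite)^('u + 'v)"
  assumes pos_def: "pos_def_matrix C"
begin

abbreviation "Cu \<equiv> C_uu C"
abbreviation "Cv \<equiv> C_vv C"
abbreviation "Su \<equiv> C_u_given_v C"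
abbreviation "Sv \<equiv> C_v_given_u C"
text \<open>The regression matrices: \<open>Mu *v v\<close> is the conditional mean of u given v,
  and \<open>Mv *v u\<close> that of v given u.\<close>

abbreviation "Mu \<equiv> C_uv C ** matrix_inv (C_vv C)"
abbreviation "Mv \<equiv> C_vu C ** matrix_inv (C_uu C)"
abbreviation "\<mu> \<equiv> joint_gaussian C"

lemma blocks_symmetric:
  "transpose Cu = Cu" "transpose Cv = Cv" "transpose (C_uv C) = C_vu C" "transpose (C_vu C) = C_uv C"
proof -
  have "transpose C = C" using pos_def by (simp add: pos_def_matrix_def)
  moreover have "transpose C $ i $ j = C $ j $ i" for i j
    by (simp add: transpose_def)
  ultimately have "C $ i $ j = C $ j $ i" for i j by simp
  from this[of "Inl _" "Inl _"] this[of "Inr _" "Inr _"] this[of "Inl _" "Inr _"]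
  show "transpose Cu = Cu" "transpose Cv = Cv" "transpose (C_uv C) = C_vu C" "transpose (C_vu C) = C_uv C"
    by (simp_all add: transpose_def C_uu_def C_uv_def C_vu_def C_vv_def vec_eq_iff)
qed

lemma blocks_pos:
  assumes "a \<noteq> 0 \<or> b \<noteq> 0"
  shows "0 < a \<bullet> (Cu *v a + C_uv C *v b) + b \<bullet> (C_vu C *v a + Cv *v b)"
proof -
  define z where "z = join_vec (a, b)"
  have z: "split_vec z = (a, b)" by (simp add: z_def)
  have "split_vec (0 :: real^('u + 'v)) = (0, 0)"
    by (simp add: split_vec_def vec_eq_iff)
  then have "z \<noteq> 0"
    using assms z by auto
  then have "0 < split_vec z \<bullet> split_vec (C *v z)"
    using pos_def by (simp add: inner_split_vec pos_def_matrix_def)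
  then show ?thesis by (simp add: split_vec_matrix z)
qed

lemma blocks_pos1:
  "a \<noteq> 0 \<or> b \<noteq> 0 \<Longrightarrow> 0 < a \<bullet> (Cu *v a + C_uv C *v b) + b \<bullet> (transpose (C_uv C) *v a + Cv *v b)"
  using blocks_pos by (simp only: blocks_symmetric)

lemma blocks_pos2:
  "b \<noteq> 0 \<or> a \<noteq> 0 \<Longrightarrow> 0 < b \<bullet> (Cv *v b + C_vu C *v a) + a \<bullet> (transpose (C_vu C) *v b + Cu *v a)"
  using blocks_pos[of a b] by (simp only: blocks_symmetric add.commute disj_commute)

lemma pos_def_blocks: "pos_def_matrix Cu" "pos_def_matrix Cv" "pos_def_matrix Su" "pos_def_matrix Sv"
  using pos_def_schur_complement(1-3)[OF blocks_symmetric(1,2) blocks_pos1]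
    pos_def_schur_complement(3)[OF blocks_symmetric(2,1) blocks_pos2]
  by (simp_all add: C_u_given_v_def C_v_given_u_def blocks_symmetric)

text \<open>The two completions of the square, eliminating v or eliminating u. The blocks of
  \<open>w\<close>, the image of the vector under C^-1, solve the block system of
  \<open>pos_def_schur_complement\<close>.\<close>

lemma quadratic_form_split:
  "join_vec (u, v) \<bullet> (matrix_inv C *v join_vec (u, v))
     = (u - Mu *v v) \<bullet> (matrix_inv Su *v (u - Mu *v v)) + v \<bullet> (matrix_inv Cv *v v)" (is "?q = ?q1")
  "join_vec (u, v) \<bullet> (matrix_inv C *v join_vec (u, v))
     = (v - Mv *v u) \<bullet> (matrix_inv Sv *v (v - Mv *v u)) + u \<bullet> (matrix_inv Cu *v u)" (is "_ = ?q2")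
proof -
  define w where "w = matrix_inv C *v join_vec (u, v)"
  have "C *v w = join_vec (u, v)"
    using pos_def_matrix_invertible[OF pos_def] by (simp add: w_def)
  then have "split_vec (C *v w) = (u, v)" by simp
  moreover obtain a b where ab: "split_vec w = (a, b)" by (rule prod.exhaust)
  ultimately have eqs: "Cu *v a + C_uv C *v b = u" "C_vu C *v a + Cv *v b = v"
    by (simp_all add: split_vec_matrix)
  have q: "?q = u \<bullet> a + v \<bullet> b"
    using inner_split_vec[of "join_vec (u, v)" w] ab by (simp add: w_def)
  show "?q = ?q1"
    unfolding q C_u_given_v_def blocks_symmetric(3)[symmetric]
    by (rule pos_def_schur_complement(4)[OF blocks_symmetric(1,2) blocks_pos1])
      (use eqs in \<open>simp_all only: blocks_symmetric\<close>)
  have "v \<bullet> b + u \<bullet> a = ?q2"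
    unfolding C_v_given_u_def blocks_symmetric(4)[symmetric]
    by (rule pos_def_schur_complement(4)[OF blocks_symmetric(2,1) blocks_pos2])
      (use eqs in \<open>simp_all only: blocks_symmetric add.commute\<close>)
  then show "?q = ?q2" unfolding q by (simp add: add.commute)
qed

lemma joint_gaussian_eq_density:
  "\<mu> = density (lborel \<Otimes>\<^sub>M lborel) (\<lambda>p. ennreal (gaussian_density 0 C (join_vec p)))"
proof -
  have "\<mu> = distr (density lborel (\<lambda>z. ennreal (gaussian_density 0 C (join_vec (split_vec z))))) borel split_vec"
    unfolding joint_gaussian_def gaussian_eq_density split_vec_def[symmetric] join_split_vec ..
  also have "\<dots> = density (distr lborel borel split_vec) (\<lambda>p. ennreal (gaussian_density 0 C (join_vec p)))"
    by (rule density_distr[symmetric]) measurable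
  finally show ?thesis by (simp add: distr_lborel_split_vec lborel_prod)
qed

lemma sets_mu [simp, measurable_cong]: "sets \<mu> = sets borel" and space_mu [simp]: "space \<mu> = UNIV"
  by (simp_all add: joint_gaussian_def)

lemma prob_space_mu: "prob_space \<mu>"
  unfolding joint_gaussian_def split_vec_def[symmetric]
  by (intro prob_space.prob_space_distr prob_space_gaussian pos_def) measurable

text \<open>\<open>K\<close> stands for a quotient of determinant factors. Both sides have total
  mass one, so \<open>K = 1\<close>; this replaces the block determinant formula.\<close>

lemma joint_normalising_constant:
  assumes K: "K > 0" and
    eq: "\<And>u v. gaussian_density 0 C (join_vec (u, v)) = K * g u v" and
    nonneg: "\<And>u v. g u v \<ge> 0" and
    int: "(\<integral>\<^sup>+p. ennreal (case p of (u, v) \<Rightarrow> g u v) \<partial>(lborel \<Otimes>\<^sub>M lborel)) = 1"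
  shows "gaussian_density 0 C (join_vec (u, v)) = g u v"
proof -
  interpret \<mu>: prob_space \<mu> by (rule prob_space_mu)
  have g: "g u v = gaussian_density 0 C (join_vec (u, v)) / K" for u v
    using K by (simp add: eq)
  have [measurable]: "(\<lambda>p. case p of (u, v) \<Rightarrow> g u v) \<in> borel_measurable (lborel \<Otimes>\<^sub>M lborel)"
    unfolding g case_prod_beta prod.collapse lborel_prod by measurable
  have "1 = (\<integral>\<^sup>+p. ennreal (gaussian_density 0 C (join_vec p)) \<partial>(lborel \<Otimes>\<^sub>M lborel))"
    using \<mu>.emeasure_space_1 unfolding joint_gaussian_eq_density
    by (simp add: emeasure_density space_pair_measure lborel_prod)
  also have "\<dots> = (\<integral>\<^sup>+p. ennreal K * ennreal (case p of (u, v) \<Rightarrow> g u v) \<partial>(lborel \<Otimes>\<^sub>M lborel))"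
    using K nonneg by (intro nn_integral_cong) (auto simp: eq ennreal_mult)
  also have "\<dots> = ennreal K"
    by (subst nn_integral_cmult) (auto simp: int)
  finally have "K = 1" using K by (simp add: ennreal_eq_1)
  then show ?thesis by (simp add: eq)
qed

end

section \<open>The model conditional\<close>

lemma exp_half_add: "exp (- (1/2) * (x + y)) = exp (- (1/2) * y) * exp (- (1/2) * (x :: real))"
  by (simp only: exp_add[symmetric]) (simp add: field_simps)

definition score :: "real^'v^'u \<Rightarrow> real^'u^'u \<Rightarrow> real^'u \<Rightarrow> real^'v \<Rightarrow> real" where
  "score A B u v = - (1/2) * (u \<bullet> (B *v u)) + u \<bullet> (A *v v)"

lemma borel_measurable_score [measurable (raw)]:
  assumes [measurable]: "f \<in> borel_measurable M" "g \<in> borel_measurable M"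
  shows "(\<lambda>x. score A B (f x) (g x)) \<in> borel_measurable M"
  unfolding score_def by measurable

section \<open>The joint density as marginal times conditional, and the model conditional\<close>

context joint_covariance
begin

text \<open>The exponents agree by the first half of \<open>quadratic_form_split\<close>; the
  remaining constant is 1 by \<open>joint_normalising_constant\<close>.\<close>

lemma gaussian_density_split_v:
  "gaussian_density 0 C (join_vec (u, v)) = gaussian_density 0 Cv v * gaussian_density (Mu *v v) Su u"
proof (rule joint_normalising_constant)
  define n where "n = sqrt ((2 * pi) ^ CARD('u + 'v) * det C)"
  define nu where "nu = sqrt ((2 * pi) ^ CARD('u) * det Su)"
  define nv where "nv = sqrt ((2 * pi) ^ CARD('v) * det Cv)"
  have pos: "n > 0" "nu > 0" "nv > 0"
    using pos_def pos_def_blocks by (simp_all add: n_def nu_def nv_def pos_def_matrix_det_pos)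
  then show "nu * nv / n > 0" by simp
  show "gaussian_density 0 C (join_vec (u, v))
      = nu * nv / n * (gaussian_density 0 Cv v * gaussian_density (Mu *v v) Su u)" for u v
    using pos unfolding gaussian_density_def n_def[symmetric] nu_def[symmetric] nv_def[symmetric]
      diff_zero quadratic_form_split(1) exp_half_add by simp
  show "gaussian_density 0 Cv v * gaussian_density (Mu *v v) Su u \<ge> 0" for u v
    using pos_def_blocks by (simp add: gaussian_density_pos less_imp_le)
  have "(\<integral>\<^sup>+p. ennreal (case p of (u, v) \<Rightarrow> gaussian_density 0 Cv v * gaussian_density (Mu *v v) Su u) \<partial>(lborel \<Otimes>\<^sub>M lborel))
      = (\<integral>\<^sup>+v. \<integral>\<^sup>+u. ennreal (gaussian_density 0 Cv v) * ennreal (gaussian_density (Mu *v v) Su u) \<partial>lborel \<partial>lborel)"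
    using pos_def_blocks
    by (subst lborel_pair.nn_integral_snd[symmetric]) (auto simp: ennreal_mult gaussian_density_pos less_imp_le)
  also have "\<dots> = 1"
    using pos_def_blocks by (simp add: nn_integral_cmult nn_integral_gaussian_density)
  finally show "(\<integral>\<^sup>+p. ennreal (case p of (u, v) \<Rightarrow> gaussian_density 0 Cv v * gaussian_density (Mu *v v) Su u) \<partial>(lborel \<Otimes>\<^sub>M lborel)) = 1" .
qed

lemma gaussian_density_split_u:
  "gaussian_density 0 C (join_vec (u, v)) = gaussian_density 0 Cu u * gaussian_density (Mv *v u) Sv v"
proof (rule joint_normalising_constant)
  define n where "n = sqrt ((2 * pi) ^ CARD('u + 'v) * det C)"
  define nu where "nu = sqrt ((2 * pi) ^ CARD('u) * det Cu)"
  define nv where "nv = sqrt ((2 * pi) ^ CARD('v) * det Sv)"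
  have pos: "n > 0" "nu > 0" "nv > 0"
    using pos_def pos_def_blocks by (simp_all add: n_def nu_def nv_def pos_def_matrix_det_pos)
  then show "nu * nv / n > 0" by simp
  show "gaussian_density 0 C (join_vec (u, v))
      = nu * nv / n * (gaussian_density 0 Cu u * gaussian_density (Mv *v u) Sv v)" for u v
    using pos unfolding gaussian_density_def n_def[symmetric] nu_def[symmetric] nv_def[symmetric]
      diff_zero quadratic_form_split(2) exp_half_add by simp
  show "gaussian_density 0 Cu u * gaussian_density (Mv *v u) Sv v \<ge> 0" for u v
    using pos_def_blocks by (simp add: gaussian_density_pos less_imp_le)
  have "(\<integral>\<^sup>+p. ennreal (case p of (u, v) \<Rightarrow> gaussian_density 0 Cu u * gaussian_density (Mv *v u) Sv v) \<partial>(lborel \<Otimes>\<^sub>M lborel))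
      = (\<integral>\<^sup>+u. \<integral>\<^sup>+v. ennreal (gaussian_density 0 Cu u) * ennreal (gaussian_density (Mv *v u) Sv v) \<partial>lborel \<partial>lborel)"
    using pos_def_blocks
    by (subst lborel.nn_integral_fst[symmetric]) (auto simp: ennreal_mult gaussian_density_pos less_imp_le)
  also have "\<dots> = 1"
    using pos_def_blocks by (simp add: nn_integral_cmult nn_integral_gaussian_density)
  finally show "(\<integral>\<^sup>+p. ennreal (case p of (u, v) \<Rightarrow> gaussian_density 0 Cu u * gaussian_density (Mv *v u) Sv v) \<partial>(lborel \<Otimes>\<^sub>M lborel)) = 1" .
qed

lemma mu_eq_v:
  "\<mu> = density (lborel \<Otimes>\<^sub>M lborel)
     (\<lambda>(u, v). ennreal (gaussian_density 0 Cv v) * ennreal (gaussian_density (Mu *v v) Su u))"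
  using pos_def_blocks unfolding joint_gaussian_eq_density
  by (intro arg_cong2[where f = density] refl ext)
    (auto simp: gaussian_density_split_v ennreal_mult gaussian_density_pos less_imp_le)

lemma mu_eq_u:
  "\<mu> = density (lborel \<Otimes>\<^sub>M lborel)
     (\<lambda>(u, v). ennreal (gaussian_density 0 Cu u) * ennreal (gaussian_density (Mv *v u) Sv v))"
  using pos_def_blocks unfolding joint_gaussian_eq_density
  by (intro arg_cong2[where f = density] refl ext)
    (auto simp: gaussian_density_split_u ennreal_mult gaussian_density_pos less_imp_le)

lemma marginal_v_mu: "marginal_v \<mu> = gaussian 0 Cv"
proof -
  show ?thesis
    unfolding marginal_v_def mu_eq_v gaussian_eq_density using pos_def_blocks
    by (intro lborel_pair.distr_density_snd) (auto simp: nn_integral_gaussian_density)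
qed

lemma marginal_u_mu: "marginal_u \<mu> = gaussian 0 Cu"
proof -
  show ?thesis
    unfolding marginal_u_def mu_eq_u gaussian_eq_density using pos_def_blocks
    by (intro lborel_pair.distr_density_fst) (auto simp: nn_integral_gaussian_density)
qed

lemma is_conditional_mu: "is_conditional_u_given_v \<mu> (\<lambda>v. gaussian (Mu *v v) Su)"
  unfolding mu_eq_v gaussian_eq_density using pos_def_blocks
  by (intro is_conditional_density)
    (auto simp: nn_integral_gaussian_density intro: lborel.sigma_finite_measure_axioms)

lemma cond_normalizer_eq:
  "cond_normalizer \<mu> A B v = (\<integral>\<^sup>+u. ennreal (exp (score A B u v)) \<partial>gaussian 0 Cu)"
  by (simp add: cond_normalizer_def marginal_u_mu score_def)

lemma model_cond_eq:
  "model_cond \<mu> A B v = density (gaussian 0 Cu) (\<lambda>u. ennreal (exp (score A B u v)) / cond_normalizer \<mu> A B v)"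
  by (simp add: model_cond_def marginal_u_mu score_def)

lemma borel_measurable_cond_normalizer [measurable]: "cond_normalizer \<mu> A B \<in> borel_measurable borel"
proof -
  interpret prob_space "gaussian 0 Cu" using pos_def_blocks by (intro prob_space_gaussian)
  show ?thesis
    unfolding cond_normalizer_eq[abs_def] by measurable
qed

lemma cond_normalizer_pos: "0 < cond_normalizer \<mu> A B v"
proof -
  interpret prob_space "gaussian 0 Cu" using pos_def_blocks by (intro prob_space_gaussian)
  have "\<not> (AE u in gaussian 0 Cu. ennreal (exp (score A B u v)) = 0)"
    by (simp add: not_le)
  then show ?thesis
    unfolding cond_normalizer_eq by (subst (asm) nn_integral_0_iff_AE[symmetric]) (auto simp: zero_less_iff_neq_zero)
qed

lemma nn_integral_model_cond:
  assumes "cond_normalizer \<mu> A B v < \<infinity>"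
  shows "(\<integral>\<^sup>+u. ennreal (exp (score A B u v)) / cond_normalizer \<mu> A B v \<partial>gaussian 0 Cu) = 1"
proof -
  have "(\<integral>\<^sup>+u. ennreal (exp (score A B u v)) / cond_normalizer \<mu> A B v \<partial>gaussian 0 Cu)
      = cond_normalizer \<mu> A B v / cond_normalizer \<mu> A B v"
    unfolding cond_normalizer_eq by (subst nn_integral_divide[symmetric]) auto
  also have "\<dots> = 1"
    using assms cond_normalizer_pos[of A B v] by (intro ennreal_divide_self) auto
  finally show ?thesis .
qed

text \<open>A Woodbury identity in disguise: B* + C_uu^-1 = C_u|v^-1. It follows by evaluating both
  completed squares at (u, 0), where the term in \<open>Sv\<close> becomes the form of
  \<open>B_star\<close>.\<close>

lemma quadratic_form_B_star:
  "u \<bullet> (B_star C *v u) = u \<bullet> (matrix_inv Su *v u) - u \<bullet> (matrix_inv Cu *v u)"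
proof -
  have Cui: "transpose (matrix_inv Cu) = matrix_inv Cu"
    using pos_def_matrix_inv[OF pos_def_blocks(1)] by (simp add: pos_def_matrix_def)
  have "u \<bullet> (matrix_inv Su *v u) = (- (Mv *v u)) \<bullet> (matrix_inv Sv *v (- (Mv *v u))) + u \<bullet> (matrix_inv Cu *v u)"
    using quadratic_form_split[of u 0] by simp
  also have "(- (Mv *v u)) \<bullet> (matrix_inv Sv *v (- (Mv *v u))) = (Mv *v u) \<bullet> (matrix_inv Sv *v (Mv *v u))"
    by (simp add: matrix_vector_mult_uminus)
  also have "\<dots> = u \<bullet> (transpose Mv *v (matrix_inv Sv *v (Mv *v u)))"
    by (simp only: inner_transpose_matrix_vector)
  also have "transpose Mv = matrix_inv Cu ** C_uv C"
    by (simp add: matrix_transpose_mul Cui blocks_symmetric)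
  also have "(matrix_inv Cu ** C_uv C) *v (matrix_inv Sv *v (Mv *v u)) = B_star C *v u"
    by (simp add: B_star_def matrix_vector_mul_assoc matrix_mul_assoc)
  finally show ?thesis by simp
qed

lemma transpose_B_star: "transpose (B_star C) = B_star C"
proof -
  have "transpose (matrix_inv Cu) = matrix_inv Cu" "transpose (matrix_inv Sv) = matrix_inv Sv"
    using pos_def_blocks[THEN pos_def_matrix_inv] by (auto simp: pos_def_matrix_def)
  then show ?thesis
    by (simp add: B_star_def matrix_transpose_mul blocks_symmetric matrix_mul_assoc)
qed

text \<open>Closed form of the normalizer at the optimum: the exponential is the remainder of
  completing the square in u, the quotient compares the normalising constants of Gaussians with
  covariances \<open>Su\<close> and \<open>Cu\<close>.\<close>

definition star_normalizer :: "real^'v \<Rightarrow> real" where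
  "star_normalizer v = exp ((1/2) * ((Mu *v v) \<bullet> (matrix_inv Su *v (Mu *v v))))
     * (sqrt ((2 * pi) ^ CARD('u) * det Su) / sqrt ((2 * pi) ^ CARD('u) * det Cu))"

lemma star_normalizer_pos: "0 < star_normalizer v"
  using pos_def_blocks by (simp add: star_normalizer_def pos_def_matrix_det_pos)

text \<open>Adding B* to the prior precision turns C_uu^-1 into C_u|v^-1, and A* v is C_u|v^-1
  applied to \<open>Mu *v v\<close>. So the exponent is a square centred at \<open>Mu *v v\<close>
  plus a term in v alone.\<close>

lemma exp_score_star:
  "gaussian_density 0 Cu u * exp (score (A_star C) (B_star C) u v)
     = star_normalizer v * gaussian_density (Mu *v v) Su u"
proof -
  define nu where "nu = sqrt ((2 * pi) ^ CARD('u) * det Cu)"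
  define ns where "ns = sqrt ((2 * pi) ^ CARD('u) * det Su)"
  have pos: "nu > 0" "ns > 0"
    using pos_def_blocks by (simp_all add: nu_def ns_def pos_def_matrix_det_pos)
  define m where "m = Mu *v v"
  have tr: "transpose (matrix_inv Su) = matrix_inv Su"
    using pos_def_matrix_inv[OF pos_def_blocks(3)] by (simp add: pos_def_matrix_def)
  have A: "u \<bullet> (A_star C *v v) = u \<bullet> (matrix_inv Su *v m)"
    by (simp add: A_star_def m_def matrix_vector_mul_assoc matrix_mul_assoc)
  have sq: "(u - m) \<bullet> (matrix_inv Su *v (u - m))
      = u \<bullet> (matrix_inv Su *v u) - 2 * (u \<bullet> (matrix_inv Su *v m)) + m \<bullet> (matrix_inv Su *v m)"
    using inner_matrix_vector_symmetric[OF tr, of m u]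
    by (simp add: matrix_vector_mult_diff_distrib inner_diff_left inner_diff_right inner_commute)
  have "- (1/2) * (u \<bullet> (matrix_inv Cu *v u)) + score (A_star C) (B_star C) u v
      = (1/2) * (m \<bullet> (matrix_inv Su *v m)) + - (1/2) * ((u - m) \<bullet> (matrix_inv Su *v (u - m)))"
    unfolding score_def A quadratic_form_B_star sq by (simp add: field_simps)
  then have "exp (- (1/2) * (u \<bullet> (matrix_inv Cu *v u))) * exp (score (A_star C) (B_star C) u v)
      = exp ((1/2) * (m \<bullet> (matrix_inv Su *v m))) * exp (- (1/2) * ((u - m) \<bullet> (matrix_inv Su *v (u - m))))"
    by (simp only: exp_add[symmetric])
  then show ?thesis
    using pos unfolding gaussian_density_def star_normalizer_def m_def[symmetric] nu_def[symmetric] ns_def[symmetric]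
      diff_zero by (simp add: field_simps)
qed

lemma cond_normalizer_star: "cond_normalizer \<mu> (A_star C) (B_star C) v = ennreal (star_normalizer v)"
proof -
  have "cond_normalizer \<mu> (A_star C) (B_star C) v
      = (\<integral>\<^sup>+u. ennreal (gaussian_density 0 Cu u) * ennreal (exp (score (A_star C) (B_star C) u v)) \<partial>lborel)"
    unfolding cond_normalizer_eq gaussian_eq_density by (rule nn_integral_density) measurable
  also have "\<dots> = (\<integral>\<^sup>+u. ennreal (star_normalizer v) * ennreal (gaussian_density (Mu *v v) Su u) \<partial>lborel)"
    using pos_def_blocks star_normalizer_pos[of v]
    by (intro nn_integral_cong) (simp add: exp_score_star gaussian_density_pos less_imp_le flip: ennreal_mult)
  also have "\<dots> = ennreal (star_normalizer v)"
    using pos_def_blocks by (simp add: nn_integral_cmult nn_integral_gaussian_density)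
  finally show ?thesis .
qed

lemma model_cond_star: "model_cond \<mu> (A_star C) (B_star C) v = gaussian (Mu *v v) Su"
proof -
  have "ennreal (gaussian_density 0 Cu u) * (ennreal (exp (score (A_star C) (B_star C) u v)) / ennreal (star_normalizer v))
      = ennreal (gaussian_density (Mu *v v) Su u)" for u
  proof -
    have "ennreal (gaussian_density 0 Cu u) * (ennreal (exp (score (A_star C) (B_star C) u v)) / ennreal (star_normalizer v))
        = ennreal (gaussian_density 0 Cu u * exp (score (A_star C) (B_star C) u v) / star_normalizer v)"
      using star_normalizer_pos[of v] pos_def_blocks
      by (simp add: divide_ennreal ennreal_mult[symmetric] gaussian_density_pos less_imp_le)
    then show ?thesis
      using star_normalizer_pos[of v] by (simp add: exp_score_star)
  qed
  then show ?thesis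
    unfolding model_cond_eq cond_normalizer_star gaussian_eq_density
    by (subst density_density_eq) auto
qed

text \<open>Expanding |Gu - Hv|^2 leaves the score at A = G^T H and B = G^T G plus |Hv|^2. The
  latter depends on v alone and moves, together with the total mass \<open>W\<close>, into the
  factor that does not affect the conditional.\<close>

lemma model_joint_conditional:
  fixes G :: "real^'u^'k::finite" and H :: "real^'v^'k"
  shows "is_conditional_u_given_v (model_joint \<mu> G H) (model_cond \<mu> (transpose G ** H) (transpose G ** G))"
proof -
  let ?A = "transpose G ** H" and ?B = "transpose G ** G"
  let ?Z = "cond_normalizer \<mu> ?A ?B"
  let ?w = "\<lambda>(u, v). ennreal (exp (- (1/2) * (norm (G *v u - H *v v))\<^sup>2))"
  let ?M = "gaussian 0 Cu \<Otimes>\<^sub>M gaussian 0 Cv"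
  define W where "W = (\<integral>\<^sup>+q. ?w q \<partial>?M)"
  interpret u: prob_space "gaussian 0 Cu" using pos_def_blocks by (intro prob_space_gaussian)
  interpret v: prob_space "gaussian 0 Cv" using pos_def_blocks by (intro prob_space_gaussian)
  have sq: "(norm (G *v u - H *v v))\<^sup>2 = u \<bullet> (?B *v u) - 2 * (u \<bullet> (?A *v v)) + (norm (H *v v))\<^sup>2" for u v
    by (simp add: power2_norm_eq_inner inner_diff_left inner_diff_right inner_commute
        inner_transpose_matrix_vector flip: matrix_vector_mul_assoc del: transpose_matrix_vector)
  have w: "?w (u, v) = ennreal (exp (- (1/2) * (norm (H *v v))\<^sup>2)) * ennreal (exp (score ?A ?B u v))" for u v
    by (simp add: sq score_def algebra_simps flip: ennreal_mult exp_add)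
  \<comment> \<open>Nonnegativity of |Gu - Hv|^2 bounds the score by |Hv|^2 / 2, uniformly in
    u.\<close>
  have fin: "?Z v < \<infinity>" for v
  proof -
    have "exp (score ?A ?B u v) \<le> exp ((1/2) * (norm (H *v v))\<^sup>2)" for u
      using sq[of u v] zero_le_power2[of "norm (G *v u - H *v v)"] by (simp add: score_def)
    then have "?Z v \<le> (\<integral>\<^sup>+u. ennreal (exp ((1/2) * (norm (H *v v))\<^sup>2)) \<partial>gaussian 0 Cu)"
      unfolding cond_normalizer_eq by (intro nn_integral_mono ennreal_leI)
    also have "\<dots> < \<infinity>" using u.emeasure_space_1 by (simp add: ennreal_mult_less_top)
    finally show ?thesis .
  qed
  \<comment> \<open>Multiplying and dividing by \<open>?Z v\<close> makes the second factor a
    probability density in u, the shape \<open>is_conditional_density\<close> asks for.\<close>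
  have hk: "?w (u, v) / W = (ennreal (exp (- (1/2) * (norm (H *v v))\<^sup>2)) * ?Z v / W) * (ennreal (exp (score ?A ?B u v)) / ?Z v)" for u v
  proof -
    have "?Z v * (ennreal (exp (score ?A ?B u v)) / ?Z v) = ennreal (exp (score ?A ?B u v))"
      using fin[of v] cond_normalizer_pos[of ?A ?B v] 
      by (simp add: ennreal_times_divide mult.commute[of "?Z v"] mult_divide_eq_ennreal)
    moreover have "a * ?Z v / W * b = a * (?Z v * b) / W" for a b
      by (simp add: divide_ennreal_def mult_ac)
    ultimately show ?thesis
      unfolding w by (simp only:)
  qed
  have "model_joint \<mu> G H = density ?M
      (\<lambda>(u, v). (ennreal (exp (- (1/2) * (norm (H *v v))\<^sup>2)) * ?Z v / W) * (ennreal (exp (score ?A ?B u v)) / ?Z v))"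
    unfolding model_joint_def Let_def marginal_u_mu marginal_v_mu W_def[symmetric]
    using hk by (intro arg_cong2[where f = density] refl ext) auto
  moreover have "is_conditional_u_given_v \<dots> (\<lambda>v. density (gaussian 0 Cu) (\<lambda>u. ennreal (exp (score ?A ?B u v)) / ?Z v))"
    by (intro is_conditional_density)
      (use fin in \<open>auto simp: nn_integral_model_cond intro: u.sigma_finite_measure_axioms v.sigma_finite_measure_axioms\<close>)
  ultimately show ?thesis
    by (simp add: model_cond_eq[abs_def])
qed

end

section \<open>Integrability of the log-normalizer\<close>

text \<open>This is cosh t >= 1, scaled by exp a.\<close>

lemma exp_add_exp_uminus_ge: "2 * exp a \<le> exp (a + t) + exp (a - t :: real)"
proof -
  have "0 \<le> (exp (t/2) - exp (- t/2))\<^sup>2" by simp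
  also have "\<dots> = exp t + exp (- t) - 2"
    by (simp add: power2_diff flip: exp_add exp_double)
  finally have "exp a * 2 \<le> exp a * (exp t + exp (- t))"
    by (intro mult_left_mono) auto
  then show ?thesis
    by (simp add: exp_add exp_diff exp_minus divide_inverse algebra_simps)
qed

text \<open>If \<open>x \<bullet> P x \<le> 0\<close>, the weight \<open>\<psi>(u) = exp (-u \<bullet> P u / 2 + u \<bullet> a)\<close> satisfies
  \<open>2 \<psi>(u) \<le> \<psi>(u + n x) + \<psi>(u - n x)\<close>; integrating over a fixed cube whose translates escape to
  infinity makes the right-hand side vanish in the limit.\<close>

lemma pos_def_matrix_if_exp_integrable:
  fixes P :: "real^'n^'n"
  assumes sym: "transpose P = P"
    and fin: "(\<integral>\<^sup>+u. ennreal (exp (- (1/2) * (u \<bullet> (P *v u)) + u \<bullet> a)) \<partial>lborel) < \<infinity>"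
  shows "pos_def_matrix P"
proof -
  have "0 < x \<bullet> (P *v x)" if x: "x \<noteq> 0" for x
  proof (rule ccontr)
    assume "\<not> 0 < x \<bullet> (P *v x)"
    then have neg: "x \<bullet> (P *v x) \<le> 0" by simp
    define e where "e u = - (1/2) * (u \<bullet> (P *v u)) + u \<bullet> a" for u
    define \<psi> where "\<psi> u = ennreal (exp (e u))" for u
    have [measurable]: "\<psi> \<in> borel_measurable borel"
      unfolding \<psi>_def e_def by measurable
    define K where "K = cbox (0 :: real^'n) One"
    have [measurable]: "K \<in> sets borel" by (simp add: K_def)
    obtain b where b: "\<And>y. y \<in> K \<Longrightarrow> norm y \<le> b"
      using bounded_cbox[of 0 "One :: real^'n"] by (auto simp: bounded_iff K_def)
    have conv: "2 * \<psi> u \<le> \<psi> (u + t *\<^sub>R x) + \<psi> (u - t *\<^sub>R x)" for u t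
    proof -
      \<comment> \<open>\<open>r\<close> is the part of \<open>e (u + t *\<^sub>R x) - e u\<close>
        that is odd in \<open>t\<close>. The even part is -t^2 (x . P x) / 2, nonnegative by
        \<open>neg\<close>, so dropping it leaves the cosh inequality.\<close>
      define r where "r = t * (x \<bullet> a - x \<bullet> (P *v u))"
      have sw: "u \<bullet> (P *v x) = x \<bullet> (P *v u)"
        using inner_matrix_vector_symmetric[OF sym, of u x] by (simp add: inner_commute)
      have "e (u + t *\<^sub>R x) = e u + r - (1/2) * (t\<^sup>2 * (x \<bullet> (P *v x)))"
           "e (u - t *\<^sub>R x) = e u - r - (1/2) * (t\<^sup>2 * (x \<bullet> (P *v x)))"
        by (simp_all add: e_def r_def matrix_vector_right_distrib matrix_vector_mult_diff_distrib
            matrix_vector_mult_scaleR inner_add_left inner_add_right inner_diff_left inner_diff_right sw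
            power2_eq_square algebra_simps)
      moreover have "t\<^sup>2 * (x \<bullet> (P *v x)) \<le> 0"
        using neg by (simp add: mult_nonneg_nonpos)
      ultimately have "exp (e u + r) \<le> exp (e (u + t *\<^sub>R x))" "exp (e u - r) \<le> exp (e (u - t *\<^sub>R x))"
        by simp_all
      with exp_add_exp_uminus_ge[of "e u" r]
      have "2 * exp (e u) \<le> exp (e (u + t *\<^sub>R x)) + exp (e (u - t *\<^sub>R x))" by linarith
      then have "ennreal (2 * exp (e u)) \<le> ennreal (exp (e (u + t *\<^sub>R x)) + exp (e (u - t *\<^sub>R x)))"
        by (rule ennreal_leI)
      then show ?thesis
        unfolding \<psi>_def by (simp add: ennreal_mult)
    qed
    \<comment> \<open>The translation passes from the weight to the cube, so that the integrable
      weight itself can serve as dominating function.\<close>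
    have shift: "(\<integral>\<^sup>+u. \<psi> (u + y) * indicator K u \<partial>lborel) = (\<integral>\<^sup>+u. \<psi> u * indicator K (u - y) \<partial>lborel)" for y
      using nn_integral_lborel_translate[of "\<lambda>u. \<psi> u * indicator K (u - y)" y] by (simp add: add.commute)
    have le: "2 * (\<integral>\<^sup>+u. \<psi> u * indicator K u \<partial>lborel)
        \<le> (\<integral>\<^sup>+u. \<psi> u * indicator K (u - t *\<^sub>R x) \<partial>lborel) + (\<integral>\<^sup>+u. \<psi> u * indicator K (u + t *\<^sub>R x) \<partial>lborel)" for t
    proof -
      have "2 * (\<integral>\<^sup>+u. \<psi> u * indicator K u \<partial>lborel) = (\<integral>\<^sup>+u. 2 * \<psi> u * indicator K u \<partial>lborel)"
        by (subst nn_integral_cmult[symmetric]) (auto simp: mult.assoc)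
      also have "\<dots> \<le> (\<integral>\<^sup>+u. \<psi> (u + t *\<^sub>R x) * indicator K u + \<psi> (u - t *\<^sub>R x) * indicator K u \<partial>lborel)"
        unfolding distrib_right[symmetric] by (intro nn_integral_mono mult_right_mono conv) auto
      also have "\<dots> = (\<integral>\<^sup>+u. \<psi> (u + t *\<^sub>R x) * indicator K u \<partial>lborel) + (\<integral>\<^sup>+u. \<psi> (u - t *\<^sub>R x) * indicator K u \<partial>lborel)"
        by (rule nn_integral_add) measurable
      finally show ?thesis
        using shift[of "t *\<^sub>R x"] shift[of "- t *\<^sub>R x"] by simp
    qed
    have lim: "(\<lambda>n. \<integral>\<^sup>+u. \<psi> u * indicator K (u + real n *\<^sub>R y) \<partial>lborel) \<longlonglongrightarrow> 0" if y: "y \<noteq> 0" for y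
    proof -
      have "(\<lambda>n. \<integral>\<^sup>+u. \<psi> u * indicator K (u + real n *\<^sub>R y) \<partial>lborel) \<longlonglongrightarrow> (\<integral>\<^sup>+(u::real^'n). 0 \<partial>lborel)"
      proof (rule nn_integral_dominated_convergence[where w = \<psi>])
        show "(\<integral>\<^sup>+u. \<psi> u \<partial>lborel) < \<infinity>" using fin by (simp add: \<psi>_def e_def)
        \<comment> \<open>For fixed \<open>u\<close> the point u + n y leaves the bounded cube once
          n |y| exceeds b + |u|, so the integrand is eventually 0.\<close>
        show "AE u in lborel. (\<lambda>n. \<psi> u * indicator K (u + real n *\<^sub>R y)) \<longlonglongrightarrow> 0"
        proof (rule AE_I2, rule tendsto_eventually)
          fix u :: "real^'n"
          obtain n0 :: nat where n0: "(b + norm u) / norm y < n0"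
            using reals_Archimedean2 by blast
          have "u + real n *\<^sub>R y \<notin> K" if "n \<ge> n0" for n
          proof
            assume "u + real n *\<^sub>R y \<in> K"
            then have "norm (u + real n *\<^sub>R y) \<le> b" by (rule b)
            moreover have "norm (real n *\<^sub>R y) \<le> norm (u + real n *\<^sub>R y) + norm u"
              using norm_triangle_ineq4[of "u + real n *\<^sub>R y" u] by simp
            ultimately have "real n * norm y \<le> b + norm u" by simp
            then have "real n \<le> (b + norm u) / norm y" using y by (simp add: field_simps)
            then show False using n0 that by linarith
          qed
          then show "\<forall>\<^sub>F n in sequentially. \<psi> u * indicator K (u + real n *\<^sub>R y) = 0"
            unfolding eventually_sequentially by (intro exI[of _ n0]) auto
        qed
      qed (auto simp: indicator_def)
      then show ?thesis by simp
    qed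
    have "(\<lambda>n. (\<integral>\<^sup>+u. \<psi> u * indicator K (u - real n *\<^sub>R x) \<partial>lborel)
        + (\<integral>\<^sup>+u. \<psi> u * indicator K (u + real n *\<^sub>R x) \<partial>lborel)) \<longlonglongrightarrow> 0 + 0"
      using lim[of "- x"] lim[of x] x by (intro tendsto_add) auto
    then have "2 * (\<integral>\<^sup>+u. \<psi> u * indicator K u \<partial>lborel) \<le> 0"
      using le by (intro LIMSEQ_le_const[where X = "\<lambda>n. (\<integral>\<^sup>+u. \<psi> u * indicator K (u - real n *\<^sub>R x) \<partial>lborel)
        + (\<integral>\<^sup>+u. \<psi> u * indicator K (u + real n *\<^sub>R x) \<partial>lborel)"]) auto
    then have "(\<integral>\<^sup>+u. \<psi> u * indicator K u \<partial>lborel) = 0" by simp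
    then have "AE u in lborel. \<psi> u * indicator K u = 0"
      by (subst (asm) nn_integral_0_iff_AE) auto
    \<comment> \<open>The weight is strictly positive, so a vanishing integral would make the unit
      cube a null set.\<close>
    then have "AE u in lborel. u \<notin> K"
      by eventually_elim (auto simp: \<psi>_def indicator_def split: if_splits)
    then have "emeasure lborel K = 0"
      by (subst (asm) AE_iff_measurable[of K]) (auto simp: K_def)
    then show False
      by (simp add: K_def)
  qed
  with sym show ?thesis by (simp add: pos_def_matrix_def)
qed

text \<open>Quadratic growth is used twice: it bounds the normalizer from below and makes the score
  integrable under the joint law.\<close>

lemma abs_score_le:
  fixes A :: "real^'v^'u" and B :: "real^'u^'u"
  obtains k where "k > 0" "\<And>u v. \<bar>score A B u v\<bar> \<le> k * ((norm u)\<^sup>2 + (norm v)\<^sup>2)"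
proof -
  obtain KA where KA: "KA > 0" "\<And>v. norm (A *v v) \<le> norm v * KA"
    using bounded_linear.pos_bounded[OF matrix_vector_mul_bounded_linear[of A]] by blast
  obtain KB where KB: "KB > 0" "\<And>u. norm (B *v u) \<le> norm u * KB"
    using bounded_linear.pos_bounded[OF matrix_vector_mul_bounded_linear[of B]] by blast
  show ?thesis
  proof
    show "KA + KB > 0" using KA KB by simp
    fix u v
    have "\<bar>u \<bullet> (B *v u)\<bar> \<le> norm u * norm (B *v u)" by (rule Cauchy_Schwarz_ineq2)
    also have "\<dots> \<le> norm u * (norm u * KB)" by (intro mult_left_mono KB) auto
    finally have 1: "\<bar>u \<bullet> (B *v u)\<bar> \<le> KB * (norm u)\<^sup>2" by (simp add: power2_eq_square mult_ac)
    have "\<bar>u \<bullet> (A *v v)\<bar> \<le> norm u * norm (A *v v)" by (rule Cauchy_Schwarz_ineq2)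
    also have "\<dots> \<le> norm u * (norm v * KA)" by (intro mult_left_mono KA) auto
    also have "\<dots> = KA * (norm u * norm v)" by simp
    also have "\<dots> \<le> KA * ((norm u)\<^sup>2 + (norm v)\<^sup>2)"
    proof (rule mult_left_mono)
      show "norm u * norm v \<le> (norm u)\<^sup>2 + (norm v)\<^sup>2"
        using sum_squares_bound[of "norm u" "norm v"] mult_nonneg_nonneg[OF norm_ge_zero norm_ge_zero, of u v]
        by linarith
    qed (use KA in simp)
    finally have 2: "\<bar>u \<bullet> (A *v v)\<bar> \<le> KA * ((norm u)\<^sup>2 + (norm v)\<^sup>2)" .
    have "KB * (norm u)\<^sup>2 \<le> KB * ((norm u)\<^sup>2 + (norm v)\<^sup>2)" using KB by (intro mult_left_mono) auto
    with 1 2 show "\<bar>score A B u v\<bar> \<le> (KA + KB) * ((norm u)\<^sup>2 + (norm v)\<^sup>2)"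
      unfolding score_def distrib_right by linarith
  qed
qed

section \<open>Two-sided bounds on the normalizer\<close>

context joint_covariance
begin

text \<open>Over Lebesgue measure the precision of the prior adds to \<open>B\<close>, which exposes
  the matrix whose positive definiteness decides finiteness.\<close>

lemma cond_normalizer_lborel:
  "cond_normalizer \<mu> A B v = ennreal (1 / sqrt ((2 * pi) ^ CARD('u) * det Cu)) *
     (\<integral>\<^sup>+u. ennreal (exp (- (1/2) * (u \<bullet> ((B + matrix_inv Cu) *v u)) + u \<bullet> (A *v v))) \<partial>lborel)"
proof -
  define n where "n = sqrt ((2 * pi) ^ CARD('u) * det Cu)"
  have n: "n > 0" using pos_def_blocks by (simp add: n_def pos_def_matrix_det_pos)
  have "gaussian_density 0 Cu u * exp (score A B u v)
      = 1 / n * exp (- (1/2) * (u \<bullet> ((B + matrix_inv Cu) *v u)) + u \<bullet> (A *v v))" for u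
    unfolding gaussian_density_def n_def[symmetric] score_def
    by (simp add: matrix_vector_mult_add_rdistrib inner_add_right algebra_simps flip: exp_add)
  then have "ennreal (gaussian_density 0 Cu u) * ennreal (exp (score A B u v))
      = ennreal (1 / n) * ennreal (exp (- (1/2) * (u \<bullet> ((B + matrix_inv Cu) *v u)) + u \<bullet> (A *v v)))" for u
    using n pos_def_blocks by (subst (1 2) ennreal_mult[symmetric]) (simp_all add: gaussian_density_pos less_imp_le)
  then show ?thesis
    unfolding cond_normalizer_eq gaussian_eq_density n_def[symmetric]
    by (subst nn_integral_density) (simp_all add: nn_integral_cmult)
qed

text \<open>Finiteness at a single point makes B + C_uu^-1 positive definite. This does not mention
  v, so for every v half of the resulting decay in u absorbs the linear term u . A v, at the price
  of a factor exp (k |v|^2).\<close>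

lemma cond_normalizer_upper:
  assumes sym: "transpose B = B" and fin: "cond_normalizer \<mu> A B v\<^sub>0 < \<infinity>"
  obtains j k where "j > 0" "k > 0" "\<And>v. cond_normalizer \<mu> A B v \<le> ennreal (j * exp (k * (norm v)\<^sup>2))"
proof -
  define n where "n = sqrt ((2 * pi) ^ CARD('u) * det Cu)"
  have n: "n > 0" using pos_def_blocks by (simp add: n_def pos_def_matrix_det_pos)
  let ?P = "B + matrix_inv Cu"
  have "pos_def_matrix ?P"
  proof (rule pos_def_matrix_if_exp_integrable)
    show "transpose ?P = ?P"
      using sym pos_def_matrix_inv[OF pos_def_blocks(1)] by (simp add: pos_def_matrix_def transpose_def vec_eq_iff)
    show "(\<integral>\<^sup>+u. ennreal (exp (- (1/2) * (u \<bullet> (?P *v u)) + u \<bullet> (A *v v\<^sub>0))) \<partial>lborel) < \<infinity>"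
      using fin n unfolding cond_normalizer_lborel n_def[symmetric] by (auto simp: ennreal_mult_less_top)
  qed
  then obtain c where c: "c > 0" "\<And>u. c * (norm u)\<^sup>2 \<le> u \<bullet> (?P *v u)"
    using pos_def_matrix_lower_bound by blast
  obtain L where L: "L > 0" "\<And>v. norm (A *v v) \<le> norm v * L"
    using bounded_linear.pos_bounded[OF matrix_vector_mul_bounded_linear[of A]] by blast
  define J where "J = (\<integral>\<^sup>+(u::real^'u). ennreal (exp (- (c/4) * (norm u)\<^sup>2)) \<partial>lborel)"
  have J: "J < \<infinity>" unfolding J_def using c(1) by (intro nn_integral_exp_norm_finite) simp
  have bound: "- (1/2) * (u \<bullet> (?P *v u)) + u \<bullet> (A *v v) \<le> L\<^sup>2 / c * (norm v)\<^sup>2 + - (c/4) * (norm u)\<^sup>2" for u v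
  proof -
    have "u \<bullet> (A *v v) \<le> norm u * norm (A *v v)" by (rule norm_cauchy_schwarz)
    also have "\<dots> \<le> norm u * (norm v * L)" by (intro mult_left_mono L) auto
    also have "\<dots> \<le> c/4 * (norm u)\<^sup>2 + L\<^sup>2 / c * (norm v)\<^sup>2"
    proof -
      \<comment> \<open>Young's inequality, weighted to use c/4 of the available rate c/2 and leave
        the c/4 that appears in \<open>J\<close>.\<close>
      have "0 \<le> (c * norm u / 2 - L * norm v)\<^sup>2 / c" using c by simp
      also have "\<dots> = c/4 * (norm u)\<^sup>2 + L\<^sup>2 / c * (norm v)\<^sup>2 - norm u * (norm v * L)"
        using c(1) by (simp add: power2_eq_square field_simps)
      finally show ?thesis by simp
    qed
    finally show ?thesis using c(2)[of u] by simp
  qed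
  show ?thesis
  proof
    \<comment> \<open>The added 1 makes the constant strictly positive, so that its logarithm can be
      taken later.\<close>
    show "enn2real J / n + 1 > 0" using n by (intro add_nonneg_pos) auto
    show "L\<^sup>2 / c > 0" using L c by simp
    fix v
    have "(\<integral>\<^sup>+u. ennreal (exp (- (1/2) * (u \<bullet> (?P *v u)) + u \<bullet> (A *v v))) \<partial>lborel)
        \<le> (\<integral>\<^sup>+(u::real^'u). ennreal (exp (L\<^sup>2 / c * (norm v)\<^sup>2)) * ennreal (exp (- (c/4) * (norm u)\<^sup>2)) \<partial>lborel)"
      using bound by (intro nn_integral_mono) (simp flip: ennreal_mult exp_add)
    also have "\<dots> = ennreal (exp (L\<^sup>2 / c * (norm v)\<^sup>2)) * J"
      unfolding J_def by (rule nn_integral_cmult) measurable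
    finally have "cond_normalizer \<mu> A B v \<le> ennreal (1 / n) * (ennreal (exp (L\<^sup>2 / c * (norm v)\<^sup>2)) * J)"
      unfolding cond_normalizer_lborel n_def[symmetric] by (rule mult_left_mono) simp
    also have "J = ennreal (enn2real J)" using J by simp
    also have "ennreal (1 / n) * (ennreal (exp (L\<^sup>2 / c * (norm v)\<^sup>2)) * ennreal (enn2real J))
        = ennreal (enn2real J / n * exp (L\<^sup>2 / c * (norm v)\<^sup>2))"
      using n by (simp flip: ennreal_mult)
    also have "\<dots> \<le> ennreal ((enn2real J / n + 1) * exp (L\<^sup>2 / c * (norm v)\<^sup>2))"
      by (intro ennreal_leI mult_right_mono) auto
    finally show "cond_normalizer \<mu> A B v \<le> ennreal ((enn2real J / n + 1) * exp (L\<^sup>2 / c * (norm v)\<^sup>2))" .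
  qed
qed

text \<open>The bound \<open>abs_score_le\<close> separates u from v: the v-factor leaves the
  integral, and what remains is a constant in (0, 1].\<close>

lemma cond_normalizer_lower:
  obtains j k where "j > 0" "k > 0" "\<And>v. ennreal (j * exp (- k * (norm v)\<^sup>2)) \<le> cond_normalizer \<mu> A B v"
proof -
  interpret prob_space "gaussian 0 Cu" using pos_def_blocks by (intro prob_space_gaussian)
  obtain k where k: "k > 0" "\<And>u v. \<bar>score A B u v\<bar> \<le> k * ((norm u)\<^sup>2 + (norm v)\<^sup>2)"
    using abs_score_le by blast
  define J where "J = (\<integral>\<^sup>+u. ennreal (exp (- k * (norm u)\<^sup>2)) \<partial>gaussian 0 Cu)"
  have "J \<le> (\<integral>\<^sup>+u. 1 \<partial>gaussian 0 Cu)"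
    unfolding J_def using k(1) by (intro nn_integral_mono) simp
  then have fin: "J \<le> 1" using emeasure_space_1 by simp
  have "\<not> (AE u in gaussian 0 Cu. ennreal (exp (- k * (norm u)\<^sup>2)) = 0)"
    by (simp add: not_le)
  then have pos: "0 < J"
    unfolding J_def by (subst (asm) nn_integral_0_iff_AE[symmetric]) (auto simp: zero_less_iff_neq_zero)
  have J: "J = ennreal (enn2real J)"
    using fin by (metis ennreal_enn2real_if ennreal_one_neq_top neq_top_trans)
  show ?thesis
  proof
    show "enn2real J > 0" using pos J by (metis ennreal_0 ennreal_less_zero_iff not_less_iff_gr_or_eq ennreal_eq_0_iff not_le)
    show "k > 0" by fact
    fix v :: "real^'v"
    have "ennreal (exp (- k * (norm v)\<^sup>2)) * J
        = (\<integral>\<^sup>+u. ennreal (exp (- k * (norm v)\<^sup>2)) * ennreal (exp (- k * (norm u)\<^sup>2)) \<partial>gaussian 0 Cu)"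
      unfolding J_def by (rule nn_integral_cmult[symmetric]) measurable
    also have "\<dots> \<le> cond_normalizer \<mu> A B v"
      unfolding cond_normalizer_eq
    proof (rule nn_integral_mono)
      fix u
      have "- k * (norm v)\<^sup>2 + - k * (norm u)\<^sup>2 \<le> score A B u v"
        using k(2)[of u v] by (simp add: algebra_simps)
      then show "ennreal (exp (- k * (norm v)\<^sup>2)) * ennreal (exp (- k * (norm u)\<^sup>2)) \<le> ennreal (exp (score A B u v))"
        by (simp flip: ennreal_mult exp_add)
    qed
    finally show "ennreal (enn2real J * exp (- k * (norm v)\<^sup>2)) \<le> cond_normalizer \<mu> A B v"
      by (subst (asm) J) (simp add: ennreal_mult mult.commute)
  qed
qed

lemma cond_normalizer_finite:
  assumes "transpose B = B" "cond_normalizer \<mu> A B v\<^sub>0 < \<infinity>"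
  shows "cond_normalizer \<mu> A B v < \<infinity>"
  by (rule cond_normalizer_upper[OF assms]) (metis ennreal_less_top infinity_ennreal_def le_less_trans)

text \<open>The logarithms of the two bounds are quadratics in v, which have finite Gaussian mean.
  This makes the second term of \<open>cond_loss\<close> a genuine expectation rather than a default
  value.\<close>

lemma integrable_ln_cond_normalizer:
  assumes sym: "transpose B = B" and fin: "cond_normalizer \<mu> A B v\<^sub>0 < \<infinity>"
  shows "integrable (gaussian 0 Cv) (\<lambda>v. ln (enn2real (cond_normalizer \<mu> A B v)))"
proof -
  interpret prob_space "gaussian 0 Cv" using pos_def_blocks by (intro prob_space_gaussian)
  obtain j k where jk: "j > 0" "k > 0" "\<And>v. cond_normalizer \<mu> A B v \<le> ennreal (j * exp (k * (norm v)\<^sup>2))"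
    using cond_normalizer_upper[OF assms] by blast
  obtain j' k' where jk': "j' > 0" "k' > 0" "\<And>v. ennreal (j' * exp (- k' * (norm v)\<^sup>2)) \<le> cond_normalizer \<mu> A B v"
    using cond_normalizer_lower[of A B] by blast
  show ?thesis
  proof (rule Bochner_Integration.integrable_bound)
    show "integrable (gaussian 0 Cv) (\<lambda>v. \<bar>ln j\<bar> + \<bar>ln j'\<bar> + (k + k') * (norm v)\<^sup>2)"
      using integrable_gaussian_norm_sq[OF pos_def_blocks(2)] by simp
    show "AE v in gaussian 0 Cv. norm (ln (enn2real (cond_normalizer \<mu> A B v)))
        \<le> norm (\<bar>ln j\<bar> + \<bar>ln j'\<bar> + (k + k') * (norm v)\<^sup>2)"
    proof (rule AE_I2)
      fix v
      define z where "z = enn2real (cond_normalizer \<mu> A B v)"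
      have z: "cond_normalizer \<mu> A B v = ennreal z"
        using cond_normalizer_finite[OF assms, of v] by (simp add: z_def)
      have "z \<ge> 0" by (simp add: z_def)
      then have up: "z \<le> j * exp (k * (norm v)\<^sup>2)" and lo: "j' * exp (- k' * (norm v)\<^sup>2) \<le> z"
        using jk(3)[of v] jk'(3)[of v] jk(1) unfolding z by (simp_all add: ennreal_le_iff)
      have zpos: "z > 0" using lo jk'(1) by (smt (verit) exp_gt_zero mult_pos_pos)
      have "ln z \<le> ln (j * exp (k * (norm v)\<^sup>2))" using up zpos jk(1) by (subst ln_le_cancel_iff) auto
      then have "ln z \<le> ln j + k * (norm v)\<^sup>2" using jk(1) by (simp add: ln_mult)
      moreover have "ln (j' * exp (- k' * (norm v)\<^sup>2)) \<le> ln z" using lo zpos jk'(1) by (subst ln_le_cancel_iff) auto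
      then have "ln j' - k' * (norm v)\<^sup>2 \<le> ln z" using jk'(1) by (simp add: ln_mult)
      moreover have "0 \<le> k * (norm v)\<^sup>2" "0 \<le> k' * (norm v)\<^sup>2" using jk jk' by simp_all
      ultimately show "norm (ln (enn2real (cond_normalizer \<mu> A B v)))
        \<le> norm (\<bar>ln j\<bar> + \<bar>ln j'\<bar> + (k + k') * (norm v)\<^sup>2)"
        unfolding z_def[symmetric] distrib_right real_norm_def by linarith
    qed
  qed measurable
qed

end

section \<open>Gibbs' inequality and the minimizer\<close>

lemma exp_eq_add_one_iff: "exp x = x + 1 \<longleftrightarrow> x = (0 :: real)"
  using ln_eq_minus_one[of "exp x"] by auto

text \<open>\<open>f\<close> and \<open>g\<close> are log-densities of probability measures relative
  to \<open>M\<close>. The function \<open>h = exp (f - g) - 1 - (f - g)\<close> is nonnegative, and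
  its mean under \<open>N\<close> is the difference of the two integrals because exp (f - g) has
  mean 1. Equality forces \<open>h = 0\<close> almost everywhere, and exp x = x + 1 only at
  0.\<close>

lemma gibbs_inequality:
  fixes f g :: "'a \<Rightarrow> real"
  assumes [measurable]: "f \<in> borel_measurable M" "g \<in> borel_measurable M"
    and f1: "(\<integral>\<^sup>+x. ennreal (exp (f x)) \<partial>M) = 1" and g1: "(\<integral>\<^sup>+x. ennreal (exp (g x)) \<partial>M) = 1"
    and int: "integrable (density M (\<lambda>x. ennreal (exp (g x)))) f" "integrable (density M (\<lambda>x. ennreal (exp (g x)))) g"
  defines "N \<equiv> density M (\<lambda>x. ennreal (exp (g x)))"
  shows "(\<integral>x. f x \<partial>N) \<le> (\<integral>x. g x \<partial>N)"
    and "(\<integral>x. f x \<partial>N) = (\<integral>x. g x \<partial>N) \<Longrightarrow> AE x in M. f x = g x"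
proof -
  interpret N: prob_space N
    by (rule prob_spaceI) (simp add: N_def emeasure_density g1)
  note int[folded N_def, simp]
  define h where "h x = exp (f x - g x) - 1 - (f x - g x)" for x
  have h_nonneg: "0 \<le> h x" for x
    using exp_ge_add_one_self[of "f x - g x"] unfolding h_def by linarith
  have "(\<integral>\<^sup>+x. ennreal (exp (f x - g x)) \<partial>N) = (\<integral>\<^sup>+x. ennreal (exp (f x)) \<partial>M)"
    unfolding N_def by (subst nn_integral_density) (auto simp flip: ennreal_mult exp_add)
  then have e1: "(\<integral>\<^sup>+x. ennreal (exp (f x - g x)) \<partial>N) = ennreal 1"
    by (simp add: f1)
  have e: "integrable N (\<lambda>x. exp (f x - g x))"
    by (rule integrableI_nn_integral_finite[OF _ _ e1]) (auto simp: N_def)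
  have "(\<integral>x. exp (f x - g x) \<partial>N) = 1"
    using e1 by (simp add: nn_integral_eq_integral[OF e])
  then have h_int: "(\<integral>x. h x \<partial>N) = (\<integral>x. g x \<partial>N) - (\<integral>x. f x \<partial>N)" and h: "integrable N h"
    unfolding h_def using e by (simp_all add: N.prob_space)
  show "(\<integral>x. f x \<partial>N) \<le> (\<integral>x. g x \<partial>N)"
    using integral_nonneg_AE[of h N] h_nonneg h_int by simp
  assume "(\<integral>x. f x \<partial>N) = (\<integral>x. g x \<partial>N)"
  then have "AE x in N. h x = 0"
    using integral_nonneg_eq_0_iff_AE[OF h] h_nonneg h_int by simp
  moreover have "f x = g x" if "h x = 0" for x
    using that exp_eq_add_one_iff[of "f x - g x"] by (simp add: h_def)
  ultimately have "AE x in N. f x = g x" by auto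
  \<comment> \<open>The density exp g never vanishes, so null sets of \<open>N\<close> are null sets
    of \<open>M\<close>.\<close>
  then show "AE x in M. f x = g x"
    unfolding N_def by (subst (asm) AE_density) auto
qed

text \<open>A nondegenerate Gaussian has full support. This upgrades almost sure equality of
  continuous functions to equality everywhere.\<close>

lemma AE_gaussian_closed:
  assumes "pos_def_matrix S" "AE x in gaussian m S. x \<in> K" "closed K"
  shows "x \<in> K"
proof -
  have [measurable]: "K \<in> sets borel" using \<open>closed K\<close> by simp
  have "AE x in lborel. x \<in> K"
    using assms(2) gaussian_density_pos[OF assms(1)] unfolding gaussian_eq_density
    by (subst (asm) AE_density) auto
  then have "AE x in lebesgue. x \<in> K" by (rule AE_completion)
  with \<open>closed K\<close> show ?thesis by (rule mem_closed_if_AE_lebesgue)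
qed

text \<open>Polarisation: expand the form at \<open>u + w\<close>.\<close>

lemma zero_if_quadratic_form_zero:
  fixes D :: "real^'n^'n"
  assumes sym: "transpose D = D" and zero: "\<And>u. u \<bullet> (D *v u) = 0"
  shows "D = 0"
proof -
  have "u \<bullet> (D *v w) = 0" for u w
    using zero[of "u + w"] zero[of u] zero[of w] inner_matrix_vector_symmetric[OF sym, of u w]
    by (simp add: matrix_vector_right_distrib inner_add_left inner_add_right inner_commute)
  then have "D *v w = 0" for w using inner_eq_zero_iff by blast
  then show ?thesis by (simp add: matrix_eq)
qed

section \<open>Log-densities relative to the product of the marginals, and strict optimality\<close>

context joint_covariance
begin

abbreviation "\<nu> \<equiv> gaussian 0 Cu \<Otimes>\<^sub>M gaussian 0 Cv"

text \<open>Where the normalizer is finite, this is the log-density relative to \<open>\<nu>\<close>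
  of the law with second marginal \<open>gaussian 0 Cv\<close> and the model conditional. All
  parameters thus share one reference measure, as \<open>gibbs_inequality\<close> requires.\<close>

definition log_cond :: "real^'v^'u \<Rightarrow> real^'u^'u \<Rightarrow> (real^'u) \<times> (real^'v) \<Rightarrow> real" where
  "log_cond A B = (\<lambda>(u, v). score A B u v - ln (enn2real (cond_normalizer \<mu> A B v)))"

lemma borel_measurable_log_cond [measurable]: "log_cond A B \<in> borel_measurable (borel \<Otimes>\<^sub>M borel)"
  unfolding log_cond_def by measurable

text \<open>By \<open>exp_score_star\<close> the quotient of conditional and prior density of u is
  exp of the score divided by the normalizer.\<close>

lemma mu_eq_log_cond: "\<mu> = density \<nu> (\<lambda>p. ennreal (exp (log_cond (A_star C) (B_star C) p)))"
proof -
  have "\<nu> = density (lborel \<Otimes>\<^sub>M lborel) (\<lambda>(u, v). ennreal (gaussian_density 0 Cu u) * ennreal (gaussian_density 0 Cv v))"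
    unfolding gaussian_eq_density
    by (rule pair_measure_density)
      (use pos_def_blocks in \<open>auto simp flip: gaussian_eq_density intro: prob_space_imp_sigma_finite prob_space_gaussian
        lborel.sigma_finite_measure_axioms\<close>)
  moreover have "gaussian_density 0 Cv v * gaussian_density (Mu *v v) Su u
      = gaussian_density 0 Cu u * gaussian_density 0 Cv v * exp (log_cond (A_star C) (B_star C) (u, v))" for u v
    using exp_score_star[of u v] star_normalizer_pos[of v]
    by (simp add: log_cond_def cond_normalizer_star less_imp_le exp_diff field_simps)
  then have "ennreal (gaussian_density 0 Cv v) * ennreal (gaussian_density (Mu *v v) Su u)
      = ennreal (gaussian_density 0 Cu u) * ennreal (gaussian_density 0 Cv v)
        * ennreal (exp (log_cond (A_star C) (B_star C) (u, v)))" for u v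
    using pos_def_blocks by (simp add: gaussian_density_pos less_imp_le flip: ennreal_mult)
  then have "\<mu> = density (lborel \<Otimes>\<^sub>M lborel) (\<lambda>p. (case p of (u, v) \<Rightarrow> ennreal (gaussian_density 0 Cu u) * ennreal (gaussian_density 0 Cv v))
      * ennreal (exp (log_cond (A_star C) (B_star C) p)))"
    unfolding mu_eq_v by (intro arg_cong2[where f = density] refl ext) auto
  ultimately show ?thesis
    by (simp add: density_density_eq)
qed

lemma nn_integral_exp_log_cond:
  assumes "\<And>v. cond_normalizer \<mu> A B v < \<infinity>"
  shows "(\<integral>\<^sup>+p. ennreal (exp (log_cond A B p)) \<partial>\<nu>) = 1"
proof -
  interpret u: prob_space "gaussian 0 Cu" using pos_def_blocks by (intro prob_space_gaussian)
  interpret v: prob_space "gaussian 0 Cv" using pos_def_blocks by (intro prob_space_gaussian)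
  interpret pair_sigma_finite "gaussian 0 Cu" "gaussian 0 Cv" ..
  have "ennreal (exp (log_cond A B (u, v))) = ennreal (exp (score A B u v)) / cond_normalizer \<mu> A B v" for u v
  proof -
    have z: "cond_normalizer \<mu> A B v = ennreal (enn2real (cond_normalizer \<mu> A B v))"
      using assms[of v] by simp
    have "0 < enn2real (cond_normalizer \<mu> A B v)"
      using assms[of v] cond_normalizer_pos[of A B v] by (simp add: enn2real_positive_iff)
    then show ?thesis
      by (subst z) (simp add: log_cond_def exp_diff divide_ennreal)
  qed
  then have "(\<integral>\<^sup>+p. ennreal (exp (log_cond A B p)) \<partial>\<nu>)
      = (\<integral>\<^sup>+v. \<integral>\<^sup>+u. ennreal (exp (score A B u v)) / cond_normalizer \<mu> A B v \<partial>gaussian 0 Cu \<partial>gaussian 0 Cv)"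
    by (subst nn_integral_snd[symmetric]) auto
  also have "\<dots> = 1"
    using assms v.emeasure_space_1 by (simp add: nn_integral_model_cond)
  finally show ?thesis .
qed

lemma measurable_mu: "f \<in> borel \<Otimes>\<^sub>M borel \<rightarrow>\<^sub>M N \<Longrightarrow> f \<in> \<mu> \<rightarrow>\<^sub>M N"
  by (simp only: borel_prod measurable_cong_sets[OF sets_mu refl])

lemma integrable_mu_norm_sq: "integrable \<mu> (\<lambda>p. (norm (fst p))\<^sup>2)" "integrable \<mu> (\<lambda>p. (norm (snd p))\<^sup>2)"
proof -
  have "fst \<in> \<mu> \<rightarrow>\<^sub>M borel" "snd \<in> \<mu> \<rightarrow>\<^sub>M borel"
    by (rule measurable_mu[OF measurable_fst] measurable_mu[OF measurable_snd])+
  note int = this[THEN integrable_distr]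
  show "integrable \<mu> (\<lambda>p. (norm (fst p))\<^sup>2)"
    using integrable_gaussian_norm_sq[OF pos_def_blocks(1)]
    unfolding marginal_u_mu[symmetric] marginal_u_def by (rule int(1))
  show "integrable \<mu> (\<lambda>p. (norm (snd p))\<^sup>2)"
    using integrable_gaussian_norm_sq[OF pos_def_blocks(2)]
    unfolding marginal_v_mu[symmetric] marginal_v_def by (rule int(2))
qed

lemma integrable_mu_score: "integrable \<mu> (\<lambda>(u, v). score A B u v)"
proof -
  obtain k where k: "k > 0" "\<And>u v. \<bar>score A B u v\<bar> \<le> k * ((norm u)\<^sup>2 + (norm v)\<^sup>2)"
    using abs_score_le by blast
  show ?thesis
  proof (rule Bochner_Integration.integrable_bound)
    show "integrable \<mu> (\<lambda>p. k * ((norm (fst p))\<^sup>2 + (norm (snd p))\<^sup>2))"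
      using integrable_mu_norm_sq by simp
    show "(\<lambda>(u, v). score A B u v) \<in> borel_measurable \<mu>"
      by (rule measurable_mu) measurable
    show "AE p in \<mu>. norm (case p of (u, v) \<Rightarrow> score A B u v) \<le> norm (k * ((norm (fst p))\<^sup>2 + (norm (snd p))\<^sup>2))"
      using k by (intro AE_I2) (force simp: split_beta)
  qed
qed

text \<open>The normalizer term of the loss is pulled back along \<open>snd\<close> to the joint
  space; as both integrands are integrable there, the two expectations merge into one.\<close>

lemma log_cond_integral:
  assumes sym: "transpose B = B" and fin: "cond_normalizer \<mu> A B v\<^sub>0 < \<infinity>"
  shows "integrable \<mu> (log_cond A B)"
    and "cond_loss \<mu> A B = ereal (- (\<integral>p. log_cond A B p \<partial>\<mu>))"
proof -
  let ?l = "\<lambda>v. ln (enn2real (cond_normalizer \<mu> A B v))"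
  have snd: "snd \<in> \<mu> \<rightarrow>\<^sub>M borel"
    by (rule measurable_mu[OF measurable_snd])
  have l: "?l \<in> borel_measurable borel" by measurable
  have i: "integrable \<mu> (\<lambda>p. ?l (snd p))"
    using integrable_ln_cond_normalizer[OF assms] unfolding marginal_v_mu[symmetric] marginal_v_def
    by (rule integrable_distr[OF snd])
  have eq: "log_cond A B = (\<lambda>p. (case p of (u, v) \<Rightarrow> score A B u v) - ?l (snd p))"
    by (auto simp: log_cond_def)
  show "integrable \<mu> (log_cond A B)"
    unfolding eq using integrable_mu_score i by (rule Bochner_Integration.integrable_diff)
  have "(\<integral>v. ?l v \<partial>marginal_v \<mu>) = (\<integral>p. ?l (snd p) \<partial>\<mu>)"
    unfolding marginal_v_def by (rule integral_distr[OF snd l])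
  moreover have "(\<integral>(u, v). (1/2) * (u \<bullet> (B *v u)) - u \<bullet> (A *v v) \<partial>\<mu>) = - (\<integral>(u, v). score A B u v \<partial>\<mu>)"
  proof -
    have "(\<lambda>(u, v). (1/2) * (u \<bullet> (B *v u)) - u \<bullet> (A *v v)) = (\<lambda>p. - (case p of (u, v) \<Rightarrow> score A B u v))"
      by (auto simp: score_def)
    then show ?thesis by (simp only: Bochner_Integration.integral_minus)
  qed
  moreover have "(\<integral>p. log_cond A B p \<partial>\<mu>) = (\<integral>(u, v). score A B u v \<partial>\<mu>) - (\<integral>p. ?l (snd p) \<partial>\<mu>)"
    unfolding eq using integrable_mu_score i by (rule Bochner_Integration.integral_diff)
  ultimately show "cond_loss \<mu> A B = ereal (- (\<integral>p. log_cond A B p \<partial>\<mu>))"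
    using cond_normalizer_finite[OF assms] by (simp add: cond_loss_def)
qed

text \<open>For fixed v both sides are quadratic polynomials in u, equal for almost every u and
  hence for all u. Parity in u separates the quadratic part, which gives B, from the linear part,
  which gives A v.\<close>

lemma log_cond_unique:
  assumes sym: "transpose B = B" "transpose B' = B'"
    and ae: "AE p in \<nu>. log_cond A B p = log_cond A' B' p"
  shows "A = A' \<and> B = B'"
proof -
  interpret u: prob_space "gaussian 0 Cu" using pos_def_blocks by (intro prob_space_gaussian)
  interpret v: prob_space "gaussian 0 Cv" using pos_def_blocks by (intro prob_space_gaussian)
  interpret pair_sigma_finite "gaussian 0 Cu" "gaussian 0 Cv" ..
  define D where "D = B - B'"
  define E where "E = A - A'"
  \<comment> \<open>The product yields u outermost; the quantifiers are then exchanged, because the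
    polynomial argument needs v fixed first.\<close>
  have "AE u in gaussian 0 Cu. AE v in gaussian 0 Cv. log_cond A B (u, v) = log_cond A' B' (u, v)"
    using ae by (rule AE_pair)
  moreover have "{p \<in> space \<nu>. log_cond A B (fst p, snd p) = log_cond A' B' (fst p, snd p)} \<in> sets \<nu>"
    by measurable
  ultimately have ae_v: "AE v in gaussian 0 Cv. AE u in gaussian 0 Cu. log_cond A B (u, v) = log_cond A' B' (u, v)"
    by (simp only: AE_commute)
  have key: "u \<bullet> (D *v u) = 0 \<and> E *v v = 0"
    if "AE u in gaussian 0 Cu. log_cond A B (u, v) = log_cond A' B' (u, v)" for u v
  proof -
    define c where "c = ln (enn2real (cond_normalizer \<mu> A B v)) - ln (enn2real (cond_normalizer \<mu> A' B' v))"
    have eq: "score A B u v - score A' B' u v = - (1/2) * (u \<bullet> (D *v u)) + u \<bullet> (E *v v)" for u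
      by (simp add: score_def D_def E_def matrix_vector_mult_diff_rdistrib inner_diff_right algebra_simps)
    have "AE u in gaussian 0 Cu. u \<in> {u. - (1/2) * (u \<bullet> (D *v u)) + u \<bullet> (E *v v) = c}"
      using that unfolding mem_Collect_eq eq[symmetric]
      by eventually_elim (simp add: log_cond_def c_def)
    moreover have "closed {u. - (1/2) * (u \<bullet> (D *v u)) + u \<bullet> (E *v v) = c}"
      by (intro closed_Collect_eq continuous_intros matrix_vector_mult_linear_continuous_on)
    ultimately have all: "- (1/2) * (u \<bullet> (D *v u)) + u \<bullet> (E *v v) = c" for u
      using AE_gaussian_closed[OF pos_def_blocks(1)] by blast
    have "c = 0" using all[of 0] by simp
    \<comment> \<open>u = 0 has removed the constant; adding and subtracting the identities at u and
      -u isolates the even and the odd part.\<close>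
    then have "u \<bullet> (D *v u) = 0 \<and> u \<bullet> (E *v v) = 0" for u
      using all[of u] all[of "- u"] by (simp add: matrix_vector_mult_uminus)
    then show ?thesis using inner_eq_zero_iff by blast
  qed
  \<comment> \<open>\<open>D\<close> does not involve v, so one good v suffices. For
    \<open>E\<close> almost all v are used, together with closedness of its kernel.\<close>
  obtain v where "AE u in gaussian 0 Cu. log_cond A B (u, v) = log_cond A' B' (u, v)"
    using eventually_happens'[OF v.ae_filter_bot ae_v] by blast
  then have "D = 0"
    using key sym by (intro zero_if_quadratic_form_zero) (auto simp: D_def transpose_diff)
  have "AE v in gaussian 0 Cv. v \<in> {v. E *v v = 0}"
    using ae_v by eventually_elim (use key in auto)
  moreover have "closed {v. E *v v = 0}"
    by (intro closed_Collect_eq continuous_intros matrix_vector_mult_linear_continuous_on)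
  ultimately have "E *v v = 0" for v
    using AE_gaussian_closed[OF pos_def_blocks(2)] by blast
  then have "E = 0" by (simp add: matrix_eq)
  with \<open>D = 0\<close> show ?thesis by (simp add: D_def E_def)
qed

text \<open>Strictness gives optimality and uniqueness at once. Equality in Gibbs' inequality would
  make the log-densities agree almost everywhere, hence the parameters; outside the finite case the
  competitor has loss infinity against a real value.\<close>

lemma cond_loss_star_less:
  assumes sym: "transpose B = B" and ne: "\<not> (A = A_star C \<and> B = B_star C)"
  shows "cond_loss \<mu> (A_star C) (B_star C) < cond_loss \<mu> A B"
proof -
  have fin_star: "cond_normalizer \<mu> (A_star C) (B_star C) v < \<infinity>" for v
    by (simp add: cond_normalizer_star)
  note star = log_cond_integral[OF transpose_B_star fin_star]
  show ?thesis
  proof (cases "AE v in gaussian 0 Cv. cond_normalizer \<mu> A B v < \<infinity>")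
    case True
    interpret v: prob_space "gaussian 0 Cv" using pos_def_blocks by (intro prob_space_gaussian)
    \<comment> \<open>An almost sure statement under a probability measure holds at some point, and
      one point of finiteness is all that \<open>log_cond_integral\<close> asks for.\<close>
    obtain v where v: "cond_normalizer \<mu> A B v < \<infinity>"
      using eventually_happens'[OF v.ae_filter_bot True] by blast
    note log_cond = log_cond_integral[OF sym v]
    note gibbs = gibbs_inequality[where M = \<nu> and f = "log_cond A B" and g = "log_cond (A_star C) (B_star C)",
        folded mu_eq_log_cond, OF _ _ nn_integral_exp_log_cond[OF cond_normalizer_finite[OF sym v]]
          nn_integral_exp_log_cond[OF fin_star] log_cond(1) star(1)]
    have "(\<integral>p. log_cond A B p \<partial>\<mu>) \<le> (\<integral>p. log_cond (A_star C) (B_star C) p \<partial>\<mu>)"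
      by (rule gibbs(1)) measurable
    moreover have "(\<integral>p. log_cond A B p \<partial>\<mu>) \<noteq> (\<integral>p. log_cond (A_star C) (B_star C) p \<partial>\<mu>)"
    proof
      assume eq: "(\<integral>p. log_cond A B p \<partial>\<mu>) = (\<integral>p. log_cond (A_star C) (B_star C) p \<partial>\<mu>)"
      have "AE p in \<nu>. log_cond A B p = log_cond (A_star C) (B_star C) p"
        by (rule gibbs(2)[OF _ _ eq]) measurable
      then show False
        using log_cond_unique[OF sym transpose_B_star] ne by blast
    qed
    ultimately show ?thesis
      by (simp add: log_cond(2) star(2))
  next
    case False
    then have "cond_loss \<mu> A B = \<infinity>"
      unfolding cond_loss_def marginal_v_mu by simp
    then show ?thesis by (simp add: star(2))
  qed
qed

lemma is_cond_loss_minimizer_iff: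
  "is_cond_loss_minimizer \<mu> A B \<longleftrightarrow> A = A_star C \<and> B = B_star C"
proof
  assume "is_cond_loss_minimizer \<mu> A B"
  then show "A = A_star C \<and> B = B_star C"
    using cond_loss_star_less[of B A] transpose_B_star
    unfolding is_cond_loss_minimizer_def is_arg_min_def by auto
next
  assume "A = A_star C \<and> B = B_star C"
  moreover have "\<not> cond_loss \<mu> A' B' < cond_loss \<mu> (A_star C) (B_star C)" if "transpose B' = B'" for A' B'
    using cond_loss_star_less[OF that, of A'] by (cases "A' = A_star C \<and> B' = B_star C") auto
  ultimately show "is_cond_loss_minimizer \<mu> A B"
    using transpose_B_star unfolding is_cond_loss_minimizer_def is_arg_min_def by auto
qed

end

theorem corollary5p4:
  fixes C :: "real^('u::finite + 'v::finite)^('u + 'v)"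
    and G :: "real^'u^'k::finite" and H :: "real^'v^'k"
  assumes "pos_def_matrix C"
  shows "is_conditional_u_given_v (model_joint (joint_gaussian C) G H)
           (model_cond (joint_gaussian C) (transpose G ** H) (transpose G ** G))
       \<and> (\<forall>A B. is_cond_loss_minimizer (joint_gaussian C) A B \<longleftrightarrow> A = A_star C \<and> B = B_star C)
       \<and> (\<forall>A B. is_cond_loss_minimizer (joint_gaussian C) A B \<longrightarrow>
            (\<forall>v. model_cond (joint_gaussian C) A B v
                 = gaussian (C_uv C ** matrix_inv (C_vv C) *v v)
                            (C_uu C - C_uv C ** matrix_inv (C_vv C) ** C_vu C))
          \<and> is_conditional_u_given_v (joint_gaussian C) (model_cond (joint_gaussian C) A B))"
proof -
  interpret joint_covariance C using assms by unfold_locales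
  have star: "model_cond (joint_gaussian C) (A_star C) (B_star C) = (\<lambda>v. gaussian (Mu *v v) Su)"
    by (simp add: fun_eq_iff model_cond_star)
  show ?thesis
    using model_joint_conditional[of G H] is_conditional_mu
    by (simp add: is_cond_loss_minimizer_iff star C_u_given_v_def)
qed

end
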